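(* Let $x_0=x_1\in\mathbb{R}^n$ and let $\{x_k\}_{k\ge 0}$ be the random iterates produced by the method mSGD/mSN/mSPP, where the momentum parameter $0\le\beta<1$ and the stepsize $\omega>0$ satisfy $\omega+2\beta<2$. Let $x_*\in\mathbb{R}^n$ be any vector satisfying $f(x_* )=0$. For $k\ge 1$ let $\hat{x}_k=\frac1k\sum_{t=1}^k x_t$. Then $$\mathbb{E}[f(\hat{x}_k)]\le\frac{(1-\beta)^2\|x_0-x_*\|_{\mathbf{B}}^2+2\omega\beta f(x_0)}{2\omega(2-2\beta-\omega)k}.$$
   Context: Let $\mathbf{A}\in\mathbb{R}^{m\times n}$ and $b\in\mathbb{R}^m$ be such that the linear system $\mathbf{A}x=b$ is consistent. Let $\mathbf{B}\in\mathbb{R}^{n\times n}$ be symmetric positive definite, $\langle x,z\rangle_{\mathbf{B}}:=x^\top\mathbf{B}z$, $\|x\|_{\mathbf{B}}:=(x^\top\mathbf{B}x)^{1/2}$. Let $\mathcal{D}$ be an arbitrary probability distribution over real matrices $\mathbf{S}$ with $m$ rows. For such $\mathbf{S}$ define $$\mathbf{H}:=\mathbf{S}(\mathbf{S}^\top\mathbf{A}\mathbf{B}^{-1}\mathbf{A}^\top\mathbf{S})^\dagger\mathbf{S}^\top,\quad f_{\mathbf{S}}(x):=\tfrac12(\mathbf{A}x-b)^\top\mathbf{H}(\mathbf{A}x-b),$$ where $\dagger$ is the Moore–Penrose pseudoinverse, and $f(x):=\mathbb{E}_{\mathbf{S}\sim\mathcal{D}}[f_{\mathbf{S}}(x)]$.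 Gradients are with respect to $\langle\cdot,\cdot\rangle_{\mathbf{B}}$, so $\nabla f_{\mathbf{S}}(x)=\mathbf{B}^{-1}\mathbf{A}^\top\mathbf{H}(\mathbf{A}x-b)$. (No exactness assumption is made: the set of minimizers of $f$ may be strictly larger than the solution set of $\mathbf{A}x=b$.) The method mSGD/mSN/mSPP (one and the same iteration) with stepsize $\omega$ and momentum parameter $\beta$: given deterministic $x_0,x_1\in\mathbb{R}^n$, for each $k\ge 1$ draw a fresh independent $\mathbf{S}_k\sim\mathcal{D}$ and set $$x_{k+1}=x_k-\omega\nabla f_{\mathbf{S}_k}(x_k)+\beta(x_k-x_{k-1}).$$ *)

theory Defs
  imports
    "HOL-Probability.Probability"
    "Jordan_Normal_Form.Gauss_Jordan_Elimination"
begin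

no_notation inner (infix "\<bullet>" 70)
no_notation Finite_Cartesian_Product.vec_nth (infixl "$" 90)
hide_const (open) Finite_Cartesian_Product.mat Finite_Cartesian_Product.vec
hide_type (open) Finite_Cartesian_Product.vec

definition is_pinv :: "real mat \<Rightarrow> real mat \<Rightarrow> bool" where
  "is_pinv M X \<longleftrightarrow>
     X \<in> carrier_mat (dim_col M) (dim_row M) \<and>
     M * X * M = M \<and> X * M * X = X \<and>
     transpose_mat (M * X) = M * X \<and> transpose_mat (X * M) = X * M"

definition pinv :: "real mat \<Rightarrow> real mat" where
  "pinv M = (THE X. is_pinv M X)"

lemma is_pinv_unique:
  assumes X: "is_pinv M X" and Y: "is_pinv M Y"
  shows "X = Y"
proof -
  define r c where "r = dim_row M" and "c = dim_col M"
  have M [simp]: "M \<in> carrier_mat r c"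
    and Xc [simp]: "X \<in> carrier_mat c r" and Yc [simp]: "Y \<in> carrier_mat c r"
    using X Y by (auto simp: is_pinv_def r_def c_def)
  have MX: "M * X * M = M" "X * M * X = X" "transpose_mat (M * X) = M * X"
      "transpose_mat (X * M) = X * M"
    and MY: "M * Y * M = M" "Y * M * Y = Y" "transpose_mat (M * Y) = M * Y"
      "transpose_mat (Y * M) = Y * M"
    using X Y by (simp_all add: is_pinv_def)
  have c1 [simp]: "M * X \<in> carrier_mat r r" "M * Y \<in> carrier_mat r r"
    "X * M \<in> carrier_mat c c" "Y * M \<in> carrier_mat c c"
    by (auto intro: mult_carrier_mat[OF M Xc] mult_carrier_mat[OF M Yc]
        mult_carrier_mat[OF Xc M] mult_carrier_mat[OF Yc M])
  have "(M * Y) * (M * X) = M * X"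
    using MY(1) assoc_mult_mat[OF c1(2) M Xc] by simp
  from arg_cong[OF this, of transpose_mat]
  have "(M * X) * (M * Y) = M * X"
    by (simp add: transpose_mult[OF c1(2) c1(1)] MX MY)
  then have a: "M * X = M * Y"
    using MX(1) assoc_mult_mat[OF c1(1) M Yc] by simp
  have "(X * M) * (Y * M) = X * (M * (Y * M))"
    by (rule assoc_mult_mat[OF Xc M c1(4)])
  also have "M * (Y * M) = M"
    using assoc_mult_mat[OF M Yc M] MY(1) by simp
  finally have "(X * M) * (Y * M) = X * M" .
  from arg_cong[OF this, of transpose_mat]
  have "(Y * M) * (X * M) = X * M"
    by (simp add: transpose_mult[OF c1(3) c1(4)] MX MY)
  moreover have "(Y * M) * (X * M) = Y * (M * (X * M))"
    by (rule assoc_mult_mat[OF Yc M c1(3)])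
  moreover have "M * (X * M) = M"
    using assoc_mult_mat[OF M Xc M] MX(1) by simp
  ultimately have d: "X * M = Y * M" by simp
  have "X = X * M * X" using MX(2) by simp
  also have "\<dots> = Y * (M * X)" using d assoc_mult_mat[OF Yc M Xc] by simp
  also have "\<dots> = Y * M * Y" using a assoc_mult_mat[OF Yc M Yc] by simp
  finally show ?thesis using MY(2) by simp
qed

lemma pinv_eqI: "is_pinv M X \<Longrightarrow> pinv M = X"
  unfolding pinv_def by (blast intro: the_equality is_pinv_unique)

definition sym_pos_def :: "nat \<Rightarrow> real mat \<Rightarrow> bool" where
  "sym_pos_def n B \<longleftrightarrow>
     B \<in> carrier_mat n n \<and> transpose_mat B = B \<and>
     (\<forall>x \<in> carrier_vec n. x \<noteq> 0\<^sub>v n \<longrightarrow> x \<bullet> (B *\<^sub>v x) > 0)"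

definition norm_B :: "real mat \<Rightarrow> real vec \<Rightarrow> real" where
  "norm_B B x = sqrt (x \<bullet> (B *\<^sub>v x))"

(* mat_inverse is option-valued; it returns Some for every invertible matrix. *)
definition mat_inv :: "real mat \<Rightarrow> real mat" where
  "mat_inv B = the (mat_inverse B)"

(* The number of columns of a sketching matrix is allowed to be random. This is the Borel
   sigma-algebra of the disjoint union, over all q, of the spaces of m x q matrices. *)
definition borel_mat :: "nat \<Rightarrow> real mat measure" where
  "borel_mat m = sigma {S. dim_row S = m}
     ({carrier_mat m q | q. True} \<union>
      {{S \<in> carrier_mat m q. S $$ (i, j) \<in> U} | q i j U. i < m \<and> j < q \<and> open U})"

definition sketch_H :: "real mat \<Rightarrow> real mat \<Rightarrow> real mat \<Rightarrow> real mat" where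
  "sketch_H A B S =
     S * pinv (transpose_mat S * A * mat_inv B * transpose_mat A * S) * transpose_mat S"

definition sketch_f :: "real mat \<Rightarrow> real mat \<Rightarrow> real vec \<Rightarrow> real mat \<Rightarrow> real vec \<Rightarrow> real" where
  "sketch_f A B b S x =
     1 / 2 * ((A *\<^sub>v x - b) \<bullet> (sketch_H A B S *\<^sub>v (A *\<^sub>v x - b)))"

definition objective ::
  "real mat measure \<Rightarrow> real mat \<Rightarrow> real mat \<Rightarrow> real vec \<Rightarrow> real vec \<Rightarrow> real" where
  "objective D A B b x = (\<integral>S. sketch_f A B b S x \<partial>D)"

(* Gradient of sketch_f with respect to the B-inner product, whence the factor mat_inv B. *)
definition sketch_grad :: "real mat \<Rightarrow> real mat \<Rightarrow> real vec \<Rightarrow> real mat \<Rightarrow> real vec \<Rightarrow> real vec" where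
  "sketch_grad A B b S x =
     mat_inv B *\<^sub>v (transpose_mat A *\<^sub>v (sketch_H A B S *\<^sub>v (A *\<^sub>v x - b)))"

(* The matrix S k is the one used in the step from iterate k to iterate k + 1, for k >= 1. *)
fun msgd ::
  "real mat \<Rightarrow> real mat \<Rightarrow> real vec \<Rightarrow> real \<Rightarrow> real \<Rightarrow> real vec \<Rightarrow> real vec \<Rightarrow>
   (nat \<Rightarrow> real mat) \<Rightarrow> nat \<Rightarrow> real vec" where
  "msgd A B b \<omega> \<beta> x0 x1 S 0 = x0"
| "msgd A B b \<omega> \<beta> x0 x1 S (Suc 0) = x1"
| "msgd A B b \<omega> \<beta> x0 x1 S (Suc (Suc k)) =
     msgd A B b \<omega> \<beta> x0 x1 S (Suc k)
     - \<omega> \<cdot>\<^sub>v sketch_grad A B b (S (Suc k)) (msgd A B b \<omega> \<beta> x0 x1 S (Suc k))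
     + \<beta> \<cdot>\<^sub>v (msgd A B b \<omega> \<beta> x0 x1 S (Suc k) - msgd A B b \<omega> \<beta> x0 x1 S k)"

definition cesaro_avg :: "nat \<Rightarrow> (nat \<Rightarrow> real vec) \<Rightarrow> nat \<Rightarrow> real vec" where
  "cesaro_avg n x k = (1 / real k) \<cdot>\<^sub>v finsum_vec TYPE(real) n x {1..k}"

end

theory Submission
  imports Defs "Jordan_Normal_Form.Determinant"
begin

text \<open>
Fix \<open>z\<close> with \<open>A z = b\<close> and write \<open>e = x - z\<close>. Everything about a sketch
\<open>S\<close> enters through the matrix \<open>G = A\<^sup>T H A\<close>: \<open>f\<^sub>S(x)\<close> is \<open>(e \<bullet> G e) / 2\<close> and
the gradient is \<open>B\<^sup>-\<^sup>1 G e\<close>. The pseudoinverse in \<open>H\<close> makes \<open>B\<^sup>-\<^sup>1 G\<close> a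
\<open>B\<close>-orthogonal projector, so \<open>G\<close> is symmetric positive semidefinite, \<open>G \<le> B\<close>, and the
squared \<open>B\<close>-norm of the gradient is exactly \<open>2 f\<^sub>S(x)\<close>.

Momentum is absorbed by a change of variables. With
\<open>V\<^sub>k = x\<^sub>k - \<beta> x\<^sub>k\<^sub>-\<^sub>1 - (1 - \<beta>) x\<^sub>*\<close> the method reads \<open>V\<^sub>k\<^sub>+\<^sub>1 = V\<^sub>k - \<omega> g\<close>, where \<open>g\<close>
is the stochastic gradient at \<open>x\<^sub>k\<close>. Expanding the square, using that the gradient of \<open>f\<^sub>S\<close>
vanishes at \<open>x\<^sub>*\<close> for almost every \<open>S\<close> (since \<open>f\<^sub>S \<ge> 0\<close> has mean zero there), and
estimating the momentum term by convexity of \<open>f\<^sub>S\<close> gives, in the \<open>B\<close>-norm,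

\<open>|V\<^sub>k\<^sub>+\<^sub>1|\<^sup>2 \<le> |V\<^sub>k|\<^sup>2 - 2 \<omega> (2 - 2 \<beta> - \<omega>) f\<^sub>S(x\<^sub>k) - 2 \<omega> \<beta> (f\<^sub>S(x\<^sub>k) - f\<^sub>S(x\<^sub>k\<^sub>-\<^sub>1))\<close>

(lemma \<open>momentum_step_le\<close>). The sketch \<open>S\<^sub>k\<close> is independent of \<open>x\<^sub>k\<close> and \<open>x\<^sub>k\<^sub>-\<^sub>1\<close>, so
in expectation \<open>f\<^sub>S\<close> may be replaced by \<open>f\<close>; the inequality telescopes to a bound on the sum of
the values \<open>E f(x\<^sub>t)\<close>, and convexity of \<open>f\<close> passes from that sum to the averaged iterate.

The measure theory rests on two facts. For a fixed \<open>h\<close>, the number \<open>h \<bullet> G h\<close> is the supremum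
of the quadratic functions \<open>2 (u \<bullet> h) - u \<bullet> B\<^sup>-\<^sup>1 u\<close> of \<open>u = A\<^sup>T S y\<close>, and rational \<open>y\<close> suffice;
hence the entries of \<open>G\<close> are measurable although the pseudoinverse is not continuous. By \<open>G \<le> B\<close>
these entries are bounded, hence so are the coordinates of every iterate, and all
expectations below are expectations of bounded random variables.
\<close>

section \<open>Existence of the Moore-Penrose pseudoinverse\<close>

definition outer_mat :: "real vec \<Rightarrow> real vec \<Rightarrow> real mat" where
  "outer_mat u v = mat (dim_vec u) (dim_vec v) (\<lambda>(i, j). u $ i * v $ j)"

lemma outer_mat_carrier [simp]:
  "u \<in> carrier_vec r \<Longrightarrow> v \<in> carrier_vec c \<Longrightarrow> outer_mat u v \<in> carrier_mat r c"
  by (auto simp: outer_mat_def)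

lemma outer_mat_mult_vec:
  assumes "v \<in> carrier_vec c" "x \<in> carrier_vec c"
  shows "outer_mat u v *\<^sub>v x = (v \<bullet> x) \<cdot>\<^sub>v u"
  using assms by (intro eq_vecI) (auto simp: outer_mat_def scalar_prod_def sum_distrib_left mult_ac)

lemma mult_outer_mat:
  assumes "M \<in> carrier_mat r c" "u \<in> carrier_vec c" "v \<in> carrier_vec d"
  shows "M * outer_mat u v = outer_mat (M *\<^sub>v u) v"
  using assms
  by (intro eq_matI)
    (auto simp: outer_mat_def scalar_prod_def sum_distrib_left sum_distrib_right mult_ac intro!: sum.cong)

lemma transpose_outer_mat: "transpose_mat (outer_mat u v) = outer_mat v u"
  by (intro eq_matI) (auto simp: outer_mat_def)

lemma scalar_prod_mult_mat_vec:
  fixes C :: "real mat"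
  assumes "C \<in> carrier_mat r c" "u \<in> carrier_vec r" "v \<in> carrier_vec c"
  shows "u \<bullet> (C *\<^sub>v v) = (transpose_mat C *\<^sub>v u) \<bullet> v"
  using transpose_vec_mult_scalar[of C r c v u] assms by simp

lemma scalar_prod_self_eq_0D:
  fixes u :: "real vec"
  assumes "u \<in> carrier_vec r" "u \<bullet> u = 0"
  shows "u = 0\<^sub>v r"
proof (rule eq_vecI)
  fix i assume i: "i < dim_vec (0\<^sub>v r)"
  have "(\<Sum>j=0..<r. u $ j * u $ j) = 0" using assms by (simp add: scalar_prod_def)
  then have "u $ i * u $ i = 0"
    using i sum_nonneg_eq_0_iff[of "{0..<r}" "\<lambda>j. u $ j * u $ j"] by auto
  then show "u $ i = 0\<^sub>v r $ i" using i by simp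
qed (use assms in auto)

text \<open>Gram--Schmidt on the columns of \<open>M\<close>, keeping the orthogonal projector onto the span of the
first \<open>j\<close> columns in the factored form \<open>M W\<close>. The factorisation is what makes the projector useful: \<open>W\<close> is a
generalised inverse of \<open>M\<close> with \<open>M W\<close> symmetric.\<close>

lemma ex_range_projector:
  assumes M: "M \<in> carrier_mat r c"
  shows "\<exists>W \<in> carrier_mat c r. M * W * M = M \<and> transpose_mat (M * W) = (M * W :: real mat)"
proof -
  have "\<exists>W \<in> carrier_mat c r. transpose_mat (M * W) = M * W \<and>
      (\<forall>v \<in> carrier_vec r. M * W *\<^sub>v (M * W *\<^sub>v v) = M * W *\<^sub>v v) \<and>
      (\<forall>i<j. M * W *\<^sub>v col M i = col M i)" if "j \<le> c" for j
    using that
  proof (induction j)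
    case 0
    have "0\<^sub>m r r *\<^sub>v v = 0\<^sub>v r" if "v \<in> carrier_vec r" for v :: "real vec"
      using that by (intro eq_vecI) auto
    then show ?case using M by (intro bexI[of _ "0\<^sub>m c r"]) auto
  next
    case (Suc j)
    then obtain W where W: "W \<in> carrier_mat c r" and sym: "transpose_mat (M * W) = M * W"
      and idem: "\<And>v. v \<in> carrier_vec r \<Longrightarrow> M * W *\<^sub>v (M * W *\<^sub>v v) = M * W *\<^sub>v v"
      and col_fixed: "\<And>i. i < j \<Longrightarrow> M * W *\<^sub>v col M i = col M i" by auto
    define P where "P = M * W"
    define a where "a = col M j"
    define t where "t = unit_vec c j - W *\<^sub>v a"
    define u where "u = a - P *\<^sub>v a"
    define s where "s = u \<bullet> u"
    \<comment> \<open>The new direction is the residual u of column j, which again lies in the range of M, as u = M t.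
        If u = 0, then s = 0 and 1 / s = 0, so nothing is added.\<close>
    define W' where "W' = W + outer_mat t ((1 / s) \<cdot>\<^sub>v u)"
    have j: "j < c" using Suc by simp
    have P: "P \<in> carrier_mat r r" using M W by (simp add: P_def)
    have a: "a \<in> carrier_vec r" using M by (auto simp: a_def col_def)
    have t: "t \<in> carrier_vec c" using W a by (simp add: t_def)
    have u: "u \<in> carrier_vec r" using P a by (simp add: u_def)
    have aM: "a = M *\<^sub>v unit_vec c j"
      using M j by (intro eq_vecI) (auto simp: a_def)
    have Mt: "M *\<^sub>v t = u"
      unfolding t_def u_def P_def using M W a
      by (simp add: mult_minus_distrib_mat_vec[OF M] aM[symmetric] assoc_mult_mat_vec[OF M W])
    have W': "W' \<in> carrier_mat c r" using W t u by (simp add: W'_def)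
    have MW': "M * W' = P + outer_mat u ((1 / s) \<cdot>\<^sub>v u)"
      using M W t u by (simp add: W'_def mult_add_distrib_mat[OF M W] P_def mult_outer_mat[OF M] Mt)
    have MW'_vec: "M * W' *\<^sub>v v = P *\<^sub>v v + (u \<bullet> v / s) \<cdot>\<^sub>v u" if "v \<in> carrier_vec r" for v
      unfolding MW' using P u that
      by (simp add: add_mult_distrib_mat_vec[of _ r r] outer_mat_mult_vec[of _ r])
    have sym': "transpose_mat (M * W') = M * W'"
      unfolding MW' using sym P u
      by (simp add: transpose_add P_def[symmetric] transpose_outer_mat)
         (auto simp: outer_mat_def intro!: eq_matI)
    have Pu: "P *\<^sub>v u = 0\<^sub>v r"
      using idem[OF a] P a by (simp add: u_def mult_minus_distrib_mat_vec[OF P] P_def[symmetric])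
    have uP: "u \<bullet> (P *\<^sub>v v) = 0" if "v \<in> carrier_vec r" for v
      using scalar_prod_mult_mat_vec[OF P u that] sym that by (simp add: P_def[symmetric] Pu)
    have us: "(s / s) \<cdot>\<^sub>v u = u"
      using scalar_prod_self_eq_0D[OF u] by (cases "s = 0") (auto simp: s_def)
    have P'u: "M * W' *\<^sub>v u = u"
      using MW'_vec[OF u] u by (simp only: Pu s_def[symmetric] us left_zero_vec)
    have u0: "0 \<cdot>\<^sub>v u = 0\<^sub>v r" using u by (intro eq_vecI) auto
    have P'P: "M * W' *\<^sub>v (P *\<^sub>v v) = P *\<^sub>v v" if "v \<in> carrier_vec r" for v
      using MW'_vec[of "P *\<^sub>v v"] idem[OF that] P u that uP[OF that]
      by (simp add: P_def[symmetric] u0)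
    have idem': "M * W' *\<^sub>v (M * W' *\<^sub>v v) = M * W' *\<^sub>v v" if v: "v \<in> carrier_vec r" for v
    proof -
      have MWc: "M * W' \<in> carrier_mat r r" using M W' by simp
      have "M * W' *\<^sub>v (P *\<^sub>v v + (u \<bullet> v / s) \<cdot>\<^sub>v u) = P *\<^sub>v v + (u \<bullet> v / s) \<cdot>\<^sub>v u"
        using P u v by (simp add: mult_add_distrib_mat_vec[OF MWc] mult_mat_vec[OF MWc] P'P P'u)
      then show ?thesis using MW'_vec[OF v] by simp
    qed
    have fix': "M * W' *\<^sub>v col M i = col M i" if "i < Suc j" for i
    proof (cases "i = j")
      case True
      have "u \<bullet> (a - P *\<^sub>v a) = u \<bullet> a"
        using uP[OF a] u a P by (simp add: scalar_prod_minus_distrib[of _ r])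
      then have "u \<bullet> a = s" by (simp add: s_def flip: u_def)
      then have "M * W' *\<^sub>v a = P *\<^sub>v a + u" using MW'_vec[OF a] us by simp
      also have "\<dots> = a" using P a by (intro eq_vecI) (auto simp: u_def)
      finally show ?thesis using True by (simp add: a_def)
    next
      case False
      then have "P *\<^sub>v col M i = col M i" using col_fixed that by (simp add: P_def)
      moreover have "col M i \<in> carrier_vec r" using M by (auto simp: col_def)
      ultimately show ?thesis using P'P[of "col M i"] by simp
    qed
    show ?case using W' sym' idem' fix' by (intro bexI[of _ W']) auto
  qed
  from this[of c] obtain W where W: "W \<in> carrier_mat c r" and sym: "transpose_mat (M * W) = M * W"
    and col_fixed: "\<And>i. i < c \<Longrightarrow> M * W *\<^sub>v col M i = col M i" by auto
  have "col (M * W * M) i = col M i" if "i < c" for i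
    using col_mult2[of "M * W" r r M c i] M W col_fixed[OF that] that by simp
  then have "M * W * M = M"
    using M W by (intro mat_col_eqI) auto
  with W sym show ?thesis by auto
qed

text \<open>Urquhart's formula: \<open>V M W\<close> is the pseudoinverse as soon as \<open>V\<close> and \<open>W\<close> are generalised inverses for
which \<open>V M\<close> and \<open>M W\<close> are symmetric. The projector lemma applied to \<open>M\<close> gives \<open>W\<close>, applied to the
transpose of \<open>M\<close> it gives \<open>V\<close>.\<close>

lemma is_pinv_pinv: "is_pinv M (pinv M)"
proof -
  define r c where "r = dim_row M" and "c = dim_col M"
  have M: "M \<in> carrier_mat r c" by (auto simp: r_def c_def)
  obtain W where W: "W \<in> carrier_mat c r" "M * W * M = M" "transpose_mat (M * W) = M * W"
    using ex_range_projector[OF M] by auto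
  have Mt: "transpose_mat M \<in> carrier_mat c r" using M by simp
  obtain U where U: "U \<in> carrier_mat r c" "transpose_mat M * U * transpose_mat M = transpose_mat M"
      "transpose_mat (transpose_mat M * U) = transpose_mat M * U"
    using ex_range_projector[OF Mt] by auto
  define V where "V = transpose_mat U"
  have V: "V \<in> carrier_mat c r" using U by (simp add: V_def)
  have VM: "V * M = transpose_mat M * U"
    using transpose_mult[OF Mt U(1)] U(3) by (simp add: V_def)
  have VM_sym: "transpose_mat (V * M) = V * M" by (simp add: VM U(3))
  have "M * (V * M) = M"
    using transpose_mult[of "transpose_mat M * U" c c "transpose_mat M" r] U M Mt
    by (simp add: VM)
  then have MVM: "M * V * M = M" using M V by simp
  define X where "X = V * M * W"
  have X: "X \<in> carrier_mat c r" using V M W by (simp add: X_def)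
  have MX: "M * X = M * W"
  proof -
    have "M * X = (M * V * M) * W" using M V W
      by (simp add: X_def assoc_mult_mat[of _ r c _ r _ c] assoc_mult_mat[of _ r c _ c _ r]
          assoc_mult_mat[of _ r r _ c _ r] assoc_mult_mat[of _ c r _ c _ r])
    then show ?thesis by (simp add: MVM)
  qed
  have XM: "X * M = V * M"
  proof -
    have "X * M = V * (M * W * M)" using M V W
      by (simp add: X_def assoc_mult_mat[of _ c r _ c _ r] assoc_mult_mat[of _ c r _ r _ c]
        assoc_mult_mat[of _ r c _ r _ c])
    then show ?thesis by (simp add: W)
  qed
  have "X * M * X = V * (M * X)" unfolding XM by (rule assoc_mult_mat[OF V M X])
  also have "\<dots> = X" unfolding MX unfolding X_def by (rule assoc_mult_mat[OF V M W(1), symmetric])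
  finally have "X * M * X = X" .
  then have "is_pinv M X"
    using X W VM_sym by (auto simp: is_pinv_def MX XM r_def c_def)
  then show ?thesis using pinv_eqI by metis
qed

lemma transpose_pinv:
  assumes "transpose_mat M = M"
  shows "transpose_mat (pinv M) = pinv M"
proof -
  define d where "d = dim_row M"
  have "dim_col M = d" using arg_cong[OF assms, of dim_row] by (simp add: d_def)
  then have M: "M \<in> carrier_mat d d" by (auto simp: d_def)
  define X where "X = pinv M"
  have X: "X \<in> carrier_mat d d" and eqs: "M * X * M = M" "X * M * X = X"
      "transpose_mat (M * X) = M * X" "transpose_mat (X * M) = X * M"
    using is_pinv_pinv[of M] M by (auto simp: is_pinv_def X_def)
  have a: "transpose_mat X * M = M * X" "M * transpose_mat X = X * M"
    using transpose_mult[OF M X] transpose_mult[OF X M] eqs assms by auto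
  have "M * transpose_mat X * M = M"
    using arg_cong[OF eqs(1), of transpose_mat] M X
    by (simp add: transpose_mult[of _ d d _ d] assms assoc_mult_mat[of _ d d _ d _ d])
  moreover have "transpose_mat X * M * transpose_mat X = transpose_mat X"
    using arg_cong[OF eqs(2), of transpose_mat] M X
    by (simp add: transpose_mult[of _ d d _ d] assms assoc_mult_mat[of _ d d _ d _ d])
  ultimately have "is_pinv M (transpose_mat X)"
    using M X a eqs by (simp add: is_pinv_def)
  then show ?thesis using pinv_eqI X_def by metis
qed

section \<open>Symmetric positive semidefinite forms\<close>

definition bform :: "real mat \<Rightarrow> real vec \<Rightarrow> real vec \<Rightarrow> real" where
  "bform C u v = u \<bullet> (C *\<^sub>v v)"

lemma bform_eq_sum:
  assumes "C \<in> carrier_mat n n" "u \<in> carrier_vec n" "v \<in> carrier_vec n"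
  shows "bform C u v = (\<Sum>i<n. \<Sum>j<n. C $$ (i, j) * (u $ i * v $ j))"
  using assms unfolding bform_def
  by (auto simp: scalar_prod_def sum_distrib_left atLeast0LessThan mult_ac intro!: sum.cong)

context
  fixes C :: "real mat" and n :: nat
  assumes C: "C \<in> carrier_mat n n"
begin

lemma bform_add_right:
  "\<lbrakk>u \<in> carrier_vec n; v \<in> carrier_vec n; w \<in> carrier_vec n\<rbrakk> \<Longrightarrow>
    bform C u (v + w) = bform C u v + bform C u w"
  using C by (simp add: bform_def mult_add_distrib_mat_vec[OF C] scalar_prod_add_distrib[of _ n])

lemma bform_add_left:
  "\<lbrakk>u \<in> carrier_vec n; v \<in> carrier_vec n; w \<in> carrier_vec n\<rbrakk> \<Longrightarrow>
    bform C (u + v) w = bform C u w + bform C v w"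
  using C by (simp add: bform_def add_scalar_prod_distrib[of _ n])

lemma bform_diff_right:
  "\<lbrakk>u \<in> carrier_vec n; v \<in> carrier_vec n; w \<in> carrier_vec n\<rbrakk> \<Longrightarrow>
    bform C u (v - w) = bform C u v - bform C u w"
  using C by (simp add: bform_def mult_minus_distrib_mat_vec[OF C] scalar_prod_minus_distrib[of _ n])

lemma bform_diff_left:
  "\<lbrakk>u \<in> carrier_vec n; v \<in> carrier_vec n; w \<in> carrier_vec n\<rbrakk> \<Longrightarrow>
    bform C (u - v) w = bform C u w - bform C v w"
  using C by (simp add: bform_def minus_scalar_prod_distrib[of _ n])

lemma bform_smult_right:
  "\<lbrakk>u \<in> carrier_vec n; v \<in> carrier_vec n\<rbrakk> \<Longrightarrow> bform C u (a \<cdot>\<^sub>v v) = a * bform C u v"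
  using C by (simp add: bform_def mult_mat_vec[OF C])

lemma bform_smult_left:
  "\<lbrakk>u \<in> carrier_vec n; v \<in> carrier_vec n\<rbrakk> \<Longrightarrow> bform C (a \<cdot>\<^sub>v u) v = a * bform C u v"
  using C by (simp add: bform_def)

lemmas bform_linear = bform_add_right bform_add_left bform_diff_right bform_diff_left
  bform_smult_right bform_smult_left

end

definition sym_psd :: "nat \<Rightarrow> real mat \<Rightarrow> bool" where
  "sym_psd n C \<longleftrightarrow> C \<in> carrier_mat n n \<and>
     (\<forall>u \<in> carrier_vec n. \<forall>v \<in> carrier_vec n. bform C u v = bform C v u) \<and>
     (\<forall>u \<in> carrier_vec n. 0 \<le> bform C u u)"

lemma sym_psdD:
  assumes "sym_psd n C"
  shows "C \<in> carrier_mat n n"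
    and "\<And>u v. u \<in> carrier_vec n \<Longrightarrow> v \<in> carrier_vec n \<Longrightarrow> bform C u v = bform C v u"
    and "\<And>u. u \<in> carrier_vec n \<Longrightarrow> 0 \<le> bform C u u"
  using assms by (auto simp: sym_psd_def)

lemma bform_commute_of_transpose:
  assumes "C \<in> carrier_mat n n" "transpose_mat C = C" "u \<in> carrier_vec n" "v \<in> carrier_vec n"
  shows "bform C u v = bform C v u"
  using scalar_prod_mult_mat_vec[OF assms(1,3,4)] assms comm_scalar_prod[of "C *\<^sub>v u" n v]
  by (simp add: bform_def)

text \<open>Convexity in first-order form. It is used for the momentum term and again for the averaged iterate.\<close>

lemma sym_psd_tangent_le:
  assumes C: "sym_psd n C" and u: "u \<in> carrier_vec n" and v: "v \<in> carrier_vec n"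
  shows "bform C v v + 2 * bform C v (u - v) \<le> bform C u u"
proof -
  note Cc = sym_psdD(1)[OF C]
  have "0 \<le> bform C (u - v) (u - v)" using sym_psdD(3)[OF C] u v by simp
  also have "\<dots> = bform C u u - bform C v v - 2 * bform C v (u - v)"
    using u v by (simp add: bform_linear[OF Cc] sym_psdD(2)[OF C u v])
  finally show ?thesis by simp
qed

section \<open>The Gram matrix of a sketch\<close>

locale sketched_system =
  fixes m n :: nat and A B :: "real mat"
  assumes A: "A \<in> carrier_mat m n" and B: "sym_pos_def n B"
begin

lemma B_carrier: "B \<in> carrier_mat n n"
  using B by (simp add: sym_pos_def_def)

lemma B_sym_psd: "sym_psd n B"
  unfolding sym_psd_def
proof (intro conjI ballI)
  fix u :: "real vec" assume "u \<in> carrier_vec n"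
  then show "0 \<le> bform B u u"
    using B B_carrier by (cases "u = 0\<^sub>v n") (auto simp: sym_pos_def_def bform_def intro: less_imp_le)
qed (use B in \<open>auto simp: sym_pos_def_def intro!: bform_commute_of_transpose\<close>)

abbreviation Binv :: "real mat" where "Binv \<equiv> mat_inv B"

lemma Binv: "B * Binv = 1\<^sub>m n" "Binv \<in> carrier_mat n n"
proof -
  have "Determinant.det B \<noteq> 0"
  proof
    assume "Determinant.det B = 0"
    then obtain v where v: "v \<in> carrier_vec n" "v \<noteq> 0\<^sub>v n" "B *\<^sub>v v = 0\<^sub>v n"
      using det_0_iff_vec_prod_zero_field[OF B_carrier] by auto
    then show False using B by (auto simp: sym_pos_def_def)
  qed
  then have "mat_inverse B \<noteq> None"
    using mat_inverse(1)[OF B_carrier, of "()"] det_non_zero_imp_unit[OF B_carrier, of "()"] by auto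
  then obtain C where "mat_inverse B = Some C" by auto
  with mat_inverse(2)[OF B_carrier this]
  show "B * Binv = 1\<^sub>m n" "Binv \<in> carrier_mat n n"
    by (auto simp: mat_inv_def)
qed

lemma B_Binv_vec: "v \<in> carrier_vec n \<Longrightarrow> B *\<^sub>v (Binv *\<^sub>v v) = v"
  using assoc_mult_mat_vec[OF B_carrier Binv(2), of v] Binv(1) by simp

lemma bform_Binv: 
  assumes "u \<in> carrier_vec n" "v \<in> carrier_vec n"
  shows "bform Binv u v = bform B (Binv *\<^sub>v u) (Binv *\<^sub>v v)"
proof -
  have c: "Binv *\<^sub>v u \<in> carrier_vec n" "Binv *\<^sub>v v \<in> carrier_vec n" using Binv assms by auto
  have "bform B (Binv *\<^sub>v u) (Binv *\<^sub>v v) = bform B (Binv *\<^sub>v v) (Binv *\<^sub>v u)"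
    using sym_psdD(2)[OF B_sym_psd c] .
  also have "\<dots> = bform Binv u v"
    using c assms comm_scalar_prod[of u n "Binv *\<^sub>v v"] by (simp add: bform_def B_Binv_vec)
  finally show ?thesis by simp
qed

lemma Binv_sym_psd: "sym_psd n Binv"
  unfolding sym_psd_def using Binv(2) sym_psdD[OF B_sym_psd] by (auto simp: bform_Binv)

lemma bform_Binv_eq_0D:
  assumes u: "u \<in> carrier_vec n" and "bform Binv u u = 0"
  shows "u = 0\<^sub>v n"
proof -
  have c: "Binv *\<^sub>v u \<in> carrier_vec n" using Binv u by auto
  have "bform B (Binv *\<^sub>v u) (Binv *\<^sub>v u) = 0" using assms by (simp add: bform_Binv)
  then have "Binv *\<^sub>v u = 0\<^sub>v n" using B c by (force simp: sym_pos_def_def bform_def)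
  then have "u = B *\<^sub>v 0\<^sub>v n" using B_Binv_vec[OF u] by simp
  also have "\<dots> = 0\<^sub>v n" using B_carrier by (intro eq_vecI) auto
  finally show ?thesis .
qed

text \<open>The matrix \<open>G\<close> of the introduction, through which the sketch enters both the objective and the gradient.\<close>

definition gram :: "real mat \<Rightarrow> real mat" where
  "gram S = transpose_mat A * sketch_H A B S * A"

text \<open>The range of this map is the range of \<open>gram S\<close>; the projector \<open>B\<^sup>-\<^sup>1 G\<close> fixes every
\<open>B\<^sup>-\<^sup>1 (sketch_dual S y)\<close>.\<close>

definition sketch_dual :: "real mat \<Rightarrow> real vec \<Rightarrow> real vec" where
  "sketch_dual S y = transpose_mat A *\<^sub>v (S *\<^sub>v y)"

context
  fixes S :: "real mat" and q :: nat
  assumes S: "S \<in> carrier_mat m q"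
begin

definition sketch_core :: "real mat" where
  "sketch_core = transpose_mat S * A * Binv * transpose_mat A * S"

definition dual_solution :: "real vec \<Rightarrow> real vec" where
  "dual_solution h = pinv sketch_core *\<^sub>v (transpose_mat S *\<^sub>v (A *\<^sub>v h))"

lemma sketch_core_factor_carriers:
  "transpose_mat S * A \<in> carrier_mat q n" "transpose_mat S * A * Binv \<in> carrier_mat q n"
  "transpose_mat S * A * Binv * transpose_mat A \<in> carrier_mat q m"
proof -
  have a: "transpose_mat S * A \<in> carrier_mat q n" using S A by simp
  note b = mult_carrier_mat[OF a Binv(2)]
  show "transpose_mat S * A \<in> carrier_mat q n" "transpose_mat S * A * Binv \<in> carrier_mat q n"
    "transpose_mat S * A * Binv * transpose_mat A \<in> carrier_mat q m"
    using a b mult_carrier_mat[OF b, of "transpose_mat A" m] A by simp_all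
qed

lemma sketch_core_carrier: "sketch_core \<in> carrier_mat q q"
  unfolding sketch_core_def using sketch_core_factor_carriers(3) S by (rule mult_carrier_mat)

lemma sketch_core_vec: 
  "y \<in> carrier_vec q \<Longrightarrow> sketch_core *\<^sub>v y = transpose_mat S *\<^sub>v (A *\<^sub>v (Binv *\<^sub>v sketch_dual S y))"
  using S A Binv(2) unfolding sketch_core_def sketch_dual_def
  by (simp add: assoc_mult_mat_vec[OF sketch_core_factor_carriers(3) S]
     assoc_mult_mat_vec[OF sketch_core_factor_carriers(2)] assoc_mult_mat_vec[OF sketch_core_factor_carriers(1) Binv(2)]
     del: assoc_mult_mat)

lemma sketch_dual_carrier [simp]: "y \<in> carrier_vec q \<Longrightarrow> sketch_dual S y \<in> carrier_vec n"
  using S A by (simp add: sketch_dual_def)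

lemma sketch_dual_scalar_prod:
  assumes "y \<in> carrier_vec q" "h \<in> carrier_vec n"
  shows "sketch_dual S y \<bullet> h = y \<bullet> (transpose_mat S *\<^sub>v (A *\<^sub>v h))"
  using scalar_prod_mult_mat_vec[of A m n "S *\<^sub>v y" h] 
    scalar_prod_mult_mat_vec[of "transpose_mat S" q m y "A *\<^sub>v h"] assms S A
  by (simp add: sketch_dual_def)

lemma bform_sketch_core: 
  assumes "y \<in> carrier_vec q" "y' \<in> carrier_vec q"
  shows "bform sketch_core y y' = bform Binv (sketch_dual S y) (sketch_dual S y')"
  using assms Binv by (simp add: bform_def sketch_core_vec sketch_dual_scalar_prod)

lemma sketch_core_sym: "transpose_mat sketch_core = sketch_core"
proof -
  have sym: "y \<bullet> (sketch_core *\<^sub>v y') = y' \<bullet> (sketch_core *\<^sub>v y)" if "y \<in> carrier_vec q" "y' \<in> carrier_vec q" for y y'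
    using bform_sketch_core[OF that] bform_sketch_core[OF that(2,1)] sym_psdD(2)[OF Binv_sym_psd] that
    by (simp add: bform_def)
  have "sketch_core $$ (j, i) = sketch_core $$ (i, j)" if "i < q" "j < q" for i j
    using sym[of "unit_vec q j" "unit_vec q i"] sketch_core_carrier that by simp
  then show ?thesis
    using sketch_core_carrier by (intro eq_matI) auto
qed

lemma pinv_sketch_core: "pinv sketch_core \<in> carrier_mat q q" "transpose_mat (pinv sketch_core) = pinv sketch_core"
    "y \<in> carrier_vec q \<Longrightarrow> sketch_core *\<^sub>v (pinv sketch_core *\<^sub>v (sketch_core *\<^sub>v y)) = sketch_core *\<^sub>v y"
    "y \<in> carrier_vec q \<Longrightarrow> pinv sketch_core *\<^sub>v (sketch_core *\<^sub>v (pinv sketch_core *\<^sub>v y)) = pinv sketch_core *\<^sub>v y"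
proof -
  show c: "pinv sketch_core \<in> carrier_mat q q" using is_pinv_pinv[of sketch_core] sketch_core_carrier by (auto simp: is_pinv_def)
  show "transpose_mat (pinv sketch_core) = pinv sketch_core" using transpose_pinv sketch_core_sym .
  note cc = sketch_core_carrier
  assume y: "y \<in> carrier_vec q"
  have "sketch_core * pinv sketch_core * sketch_core *\<^sub>v y = sketch_core *\<^sub>v y" "pinv sketch_core * sketch_core * pinv sketch_core *\<^sub>v y = pinv sketch_core *\<^sub>v y"
    using is_pinv_pinv[of sketch_core] by (auto simp: is_pinv_def)
  then show "sketch_core *\<^sub>v (pinv sketch_core *\<^sub>v (sketch_core *\<^sub>v y)) = sketch_core *\<^sub>v y"
    "pinv sketch_core *\<^sub>v (sketch_core *\<^sub>v (pinv sketch_core *\<^sub>v y)) = pinv sketch_core *\<^sub>v y"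
    using c cc y by (simp_all add: assoc_mult_mat_vec[of _ q q _ q] assoc_mult_mat[of _ q q _ q _ q])
qed

text \<open>Write \<open>M\<close> for \<open>sketch_core\<close>. The pseudoinverse identity says that \<open>d = y - M\<^sup>+ M y\<close> is annihilated by \<open>M\<close>. As
\<open>d \<bullet> M d\<close> is the squared \<open>B\<^sup>-\<^sup>1\<close>-norm of \<open>A\<^sup>T S d\<close>, definiteness of \<open>B\<close> lifts this to
\<open>A\<^sup>T S d = 0\<close>.\<close>

lemma sketch_dual_pinv_sketch_core:
  assumes y: "y \<in> carrier_vec q"
  shows "sketch_dual S (pinv sketch_core *\<^sub>v (sketch_core *\<^sub>v y)) = sketch_dual S y"
proof -
  define d where "d = y - pinv sketch_core *\<^sub>v (sketch_core *\<^sub>v y)"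
  have c: "pinv sketch_core *\<^sub>v (sketch_core *\<^sub>v y) \<in> carrier_vec q" using pinv_sketch_core(1) sketch_core_carrier y by simp
  then have d: "d \<in> carrier_vec q" using y by (simp add: d_def)
  have "sketch_core *\<^sub>v d = 0\<^sub>v q"
    using c y sketch_core_carrier by (simp add: d_def mult_minus_distrib_mat_vec[OF sketch_core_carrier] pinv_sketch_core)
  then have "bform Binv (sketch_dual S d) (sketch_dual S d) = 0"
    using d by (simp flip: bform_sketch_core) (simp add: bform_def)
  then have 0: "sketch_dual S d = 0\<^sub>v n" using bform_Binv_eq_0D d by simp
  have diff: "sketch_dual S d = sketch_dual S y - sketch_dual S (pinv sketch_core *\<^sub>v (sketch_core *\<^sub>v y))"
    using S A c y by (simp add: sketch_dual_def d_def mult_minus_distrib_mat_vec[of _ m q] 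
       mult_minus_distrib_mat_vec[of _ n m])
  show ?thesis
  proof (rule eq_vecI)
    fix i assume "i < dim_vec (sketch_dual S y)"
    then have i: "i < n" using sketch_dual_carrier[OF y] by simp
    have "(sketch_dual S y - sketch_dual S (pinv sketch_core *\<^sub>v (sketch_core *\<^sub>v y))) $ i = 0"
      using 0 diff i by simp
    then show "sketch_dual S (pinv sketch_core *\<^sub>v (sketch_core *\<^sub>v y)) $ i = sketch_dual S y $ i"
      using i sketch_dual_carrier[OF y] sketch_dual_carrier[OF c] by simp
  qed (use sketch_dual_carrier[OF y] sketch_dual_carrier[OF c] in auto)
qed

lemma sketch_H_carrier: "sketch_H A B S \<in> carrier_mat m m"
  using S pinv_sketch_core(1) by (simp add: sketch_H_def flip: sketch_core_def)

lemma gram_carrier: "gram S \<in> carrier_mat n n"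
  using A sketch_H_carrier by (simp add: gram_def)

lemma dual_solution_carrier [simp]: "h \<in> carrier_vec n \<Longrightarrow> dual_solution h \<in> carrier_vec q"
  using pinv_sketch_core(1) S A by (simp add: dual_solution_def)

lemma gram_vec: 
  assumes h: "h \<in> carrier_vec n"
  shows "gram S *\<^sub>v h = sketch_dual S (dual_solution h)"
proof -
  note p = pinv_sketch_core(1)
  have "sketch_H A B S *\<^sub>v v = S *\<^sub>v (pinv sketch_core *\<^sub>v (transpose_mat S *\<^sub>v v))" if "v \<in> carrier_vec m" for v
    using that S p unfolding sketch_H_def sketch_core_def[symmetric]
    by (simp add: assoc_mult_mat_vec[of _ m q _ m] assoc_mult_mat_vec[of _ m q _ q])
  then show ?thesis
    using A h sketch_H_carrier unfolding gram_def sketch_dual_def dual_solution_def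
    by (simp add: assoc_mult_mat_vec[of _ n m _ n] assoc_mult_mat_vec[of _ n m _ m])
qed

text \<open>This is the identity \<open>G B\<^sup>-\<^sup>1 G = G\<close>, the projector property. In particular, the squared \<open>B\<close>-norm of the gradient
is twice the value of the sketched objective.\<close>

lemma bform_gram: 
  assumes "u \<in> carrier_vec n" "v \<in> carrier_vec n"
  shows "bform (gram S) u v = bform Binv (gram S *\<^sub>v u) (gram S *\<^sub>v v)"
proof -
  have Su: "transpose_mat S *\<^sub>v (A *\<^sub>v u) \<in> carrier_vec q" if "u \<in> carrier_vec n" for u 
    using S A that by simp
  have sketch_core_dual_solution: "pinv sketch_core *\<^sub>v (sketch_core *\<^sub>v dual_solution v) = dual_solution v"
    using assms Su unfolding dual_solution_def by (simp add: pinv_sketch_core)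
  have "bform (gram S) u v = dual_solution v \<bullet> (transpose_mat S *\<^sub>v (A *\<^sub>v u))"
    using assms comm_scalar_prod[of u n "sketch_dual S (dual_solution v)"]
    by (simp add: bform_def gram_vec sketch_dual_scalar_prod)
  also have "\<dots> = (sketch_core *\<^sub>v dual_solution v) \<bullet> dual_solution u"
    using scalar_prod_mult_mat_vec[OF pinv_sketch_core(1), of "sketch_core *\<^sub>v dual_solution v" "transpose_mat S *\<^sub>v (A *\<^sub>v u)"] 
     assms Su sketch_core_carrier by (simp add: pinv_sketch_core(2) sketch_core_dual_solution) (simp add: dual_solution_def)
  also have "\<dots> = bform sketch_core (dual_solution u) (dual_solution v)"
    using assms sketch_core_carrier comm_scalar_prod[of "sketch_core *\<^sub>v dual_solution v" q "dual_solution u"] by (simp add: bform_def)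
  also have "\<dots> = bform Binv (gram S *\<^sub>v u) (gram S *\<^sub>v v)"
    using assms by (simp add: bform_sketch_core gram_vec)
  finally show ?thesis .
qed

lemma gram_sym_psd: "sym_psd n (gram S)"
  unfolding sym_psd_def
  using gram_carrier sym_psdD(2,3)[OF Binv_sym_psd] by (auto simp: bform_gram)

lemma gram_Binv_sketch_dual:
  assumes y: "y \<in> carrier_vec q"
  shows "gram S *\<^sub>v (Binv *\<^sub>v sketch_dual S y) = sketch_dual S y"
  using sketch_dual_pinv_sketch_core[OF y] Binv y
  by (simp add: gram_vec dual_solution_def sketch_core_vec)

text \<open>A projector does not increase the norm: the difference of the two sides is the squared \<open>B\<close>-norm of
\<open>h - B\<^sup>-\<^sup>1 G h\<close>.\<close>

lemma gram_le_B:
  assumes h: "h \<in> carrier_vec n"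
  shows "bform (gram S) h h \<le> bform B h h"
proof -
  define g where "g = Binv *\<^sub>v (gram S *\<^sub>v h)"
  have g: "g \<in> carrier_vec n" using h Binv gram_carrier by (simp add: g_def)
  have c: "gram S *\<^sub>v h \<in> carrier_vec n" using h gram_carrier by simp
  have hg: "bform B h g = bform (gram S) h h"
    using c by (simp add: g_def bform_def B_Binv_vec)
  have gg: "bform B g g = bform (gram S) h h"
    using c h by (simp add: g_def bform_Binv[symmetric] bform_gram[symmetric])
  show ?thesis
    using sym_psdD(3)[OF B_sym_psd, of "h - g"] h g sym_psdD(2)[OF B_sym_psd h g]
    by (simp add: bform_linear[OF B_carrier] hg gg)
qed

text \<open>With \<open>a = B\<^sup>-\<^sup>1 A\<^sup>T S y\<close> the left-hand side is \<open>2 (h \<bullet> G a) - a \<bullet> G a\<close>, so the two sides differ by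
the value of the form \<open>G\<close> at \<open>h - a\<close>. This and the next lemma present \<open>h \<bullet> G h\<close> as a maximum
of functions that are polynomial in the entries of \<open>S\<close>.\<close>

lemma bform_gram_variational_le:
  assumes y: "y \<in> carrier_vec q" and h: "h \<in> carrier_vec n"
  shows "2 * (sketch_dual S y \<bullet> h) - bform Binv (sketch_dual S y) (sketch_dual S y) \<le> bform (gram S) h h"
proof -
  define a where "a = Binv *\<^sub>v sketch_dual S y"
  have a: "a \<in> carrier_vec n" using y Binv by (simp add: a_def)
  have Ga: "gram S *\<^sub>v a = sketch_dual S y" using gram_Binv_sketch_dual[OF y] by (simp add: a_def)
  have "sketch_dual S y \<bullet> h = bform (gram S) h a"
    using y h comm_scalar_prod[of h n] by (simp add: bform_def Ga)
  moreover have "bform Binv (sketch_dual S y) (sketch_dual S y) = bform (gram S) a a"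
    using a by (simp add: bform_gram Ga)
  ultimately show ?thesis
    using sym_psdD(3)[OF gram_sym_psd, of "h - a"] h a sym_psdD(2)[OF gram_sym_psd h a]
    by (simp add: bform_linear[OF gram_carrier])
qed

lemma bform_gram_variational_eq:
  assumes h: "h \<in> carrier_vec n"
  shows "\<exists>y \<in> carrier_vec q. 
    2 * (sketch_dual S y \<bullet> h) - bform Binv (sketch_dual S y) (sketch_dual S y) = bform (gram S) h h"
proof (rule bexI)
  have "sketch_dual S (dual_solution h) \<bullet> h = bform (gram S) h h"
    using h comm_scalar_prod[of h n "sketch_dual S (dual_solution h)"] by (simp add: bform_def gram_vec)
  then show "2 * (sketch_dual S (dual_solution h) \<bullet> h) - bform Binv (sketch_dual S (dual_solution h)) (sketch_dual S (dual_solution h)) 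
     = bform (gram S) h h"
    using bform_gram[OF h h] by (simp add: gram_vec[OF h])
qed (use h in simp)

lemma residual_eq:
  assumes "z \<in> carrier_vec n" "x \<in> carrier_vec n"
  shows "A *\<^sub>v x - A *\<^sub>v z = A *\<^sub>v (x - z)"
  using A assms by (simp add: mult_minus_distrib_mat_vec[of _ m n])

lemma sketch_f_eq_bform:
  assumes z: "z \<in> carrier_vec n" and x: "x \<in> carrier_vec n"
  shows "sketch_f A B (A *\<^sub>v z) S x = bform (gram S) (x - z) (x - z) / 2"
proof -
  define e where "e = x - z"
  have e: "e \<in> carrier_vec n" using x z by (simp add: e_def)
  show ?thesis
    using e A sketch_H_carrier scalar_prod_mult_mat_vec[of "transpose_mat A" n m e "sketch_H A B S *\<^sub>v (A *\<^sub>v e)"]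
    unfolding sketch_f_def residual_eq[OF z x] bform_def gram_def e_def[symmetric]
    by (simp add: assoc_mult_mat_vec[of _ n m _ n] assoc_mult_mat_vec[of _ n m _ m])
qed

lemma sketch_grad_eq:
  assumes z: "z \<in> carrier_vec n" and x: "x \<in> carrier_vec n"
  shows "sketch_grad A B (A *\<^sub>v z) S x = Binv *\<^sub>v (gram S *\<^sub>v (x - z))"
  using A sketch_H_carrier x z
  unfolding sketch_grad_def residual_eq[OF z x] gram_def
  by (simp add: assoc_mult_mat_vec[of _ n m _ n] assoc_mult_mat_vec[of _ n m _ m])

end

end

section \<open>Measurability of the Gram matrix\<close>

lemma borel_mat_generators:
  "{carrier_mat m q | q. True} \<union>
      {{S \<in> carrier_mat m q. S $$ (i, j) \<in> U} | q i j U. i < m \<and> j < q \<and> open U}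
    \<subseteq> Pow {S :: real mat. dim_row S = m}"
  using carrier_matD(1) by blast

lemma space_borel_mat: "space (borel_mat m) = {S. dim_row S = m}"
  unfolding borel_mat_def using borel_mat_generators by (rule space_measure_of)

lemma sets_borel_mat: "sets (borel_mat m) = sigma_sets {S. dim_row S = m}
     ({carrier_mat m q | q. True} \<union>
      {{S \<in> carrier_mat m q. S $$ (i, j) \<in> U} | q i j U. i < m \<and> j < q \<and> open U})"
  unfolding borel_mat_def using borel_mat_generators by (rule sets_measure_of)

lemma carrier_mat_in_sets_borel_mat: "carrier_mat m q \<in> sets (borel_mat m)"
  unfolding sets_borel_mat by (rule sigma_sets.Basic, rule UnI1) blast

text \<open>The value \<open>0\<close> outside the stratum of matrices with \<open>q\<close> columns makes each entry a total measurable function.\<close>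

definition entry :: "nat \<Rightarrow> nat \<Rightarrow> nat \<Rightarrow> nat \<Rightarrow> real mat \<Rightarrow> real" where
  "entry m q i j S = (if S \<in> carrier_mat m q then S $$ (i, j) else 0)"

lemma entry_measurable:
  assumes ij: "i < m" "j < q"
  shows "entry m q i j \<in> borel_measurable (borel_mat m)"
proof (rule borel_measurableI)
  fix U :: "real set" assume U: "open U"
  let ?V = "{S \<in> carrier_mat m q. S $$ (i, j) \<in> U}"
  have "\<exists>q' i' j' U'. ?V = {S \<in> carrier_mat m q'. S $$ (i', j') \<in> U'} \<and> i' < m \<and> j' < q' \<and> open U'"
    using ij U by (intro exI[of _ q] exI[of _ i] exI[of _ j] exI[of _ U]) simp
  then have V: "?V \<in> sets (borel_mat m)"
    unfolding sets_borel_mat by (intro sigma_sets.Basic UnI2 CollectI)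
  have sub: "carrier_mat m q \<subseteq> space (borel_mat m)"
    by (rule sets.sets_into_space[OF carrier_mat_in_sets_borel_mat])
  show "entry m q i j -` U \<inter> space (borel_mat m) \<in> sets (borel_mat m)"
  proof (cases "0 \<in> U")
    case True
    then have "entry m q i j -` U \<inter> space (borel_mat m) = ?V \<union> (space (borel_mat m) - carrier_mat m q)"
      using sub unfolding entry_def by (intro Set.set_eqI) (simp add: subset_iff; metis)
    then show ?thesis using V carrier_mat_in_sets_borel_mat by (simp add: sets.Un sets.Diff)
  next
    case False
    then have "entry m q i j -` U \<inter> space (borel_mat m) = ?V"
      using sub unfolding entry_def by (intro Set.set_eqI) (simp add: subset_iff; metis)
    then show ?thesis using V by simp
  qed
qed

lemma floor_quotient_tendsto:
  fixes y :: real
  shows "(\<lambda>r. real_of_int \<lfloor>y * real (Suc r)\<rfloor> / real (Suc r)) \<longlonglongrightarrow> y"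
proof (rule tendsto_sandwich)
  show "(\<lambda>r. y + - inverse (real (Suc r))) \<longlonglongrightarrow> y" by (rule LIMSEQ_inverse_real_of_nat_add_minus)
  show "\<forall>\<^sub>F r in sequentially. y + - inverse (real (Suc r)) \<le> real_of_int \<lfloor>y * real (Suc r)\<rfloor> / real (Suc r)"
  proof (intro always_eventually allI)
    fix r :: nat
    have "(y + - inverse (real (Suc r))) * real (Suc r) = y * real (Suc r) - 1"
      by (simp add: field_simps)
    also have "\<dots> \<le> real_of_int \<lfloor>y * real (Suc r)\<rfloor>" by linarith
    finally show "y + - inverse (real (Suc r)) \<le> real_of_int \<lfloor>y * real (Suc r)\<rfloor> / real (Suc r)"
      by (simp add: pos_le_divide_eq del: of_nat_Suc)
  qed
  show "\<forall>\<^sub>F r in sequentially. real_of_int \<lfloor>y * real (Suc r)\<rfloor> / real (Suc r) \<le> y"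
    by (intro always_eventually allI) (simp add: pos_divide_le_eq del: of_nat_Suc)
qed simp

context sketched_system
begin

text \<open>\<open>dual_coord\<close> and \<open>dual_value\<close> are \<open>A\<^sup>T S y\<close> and the functional of \<open>bform_gram_variational_le\<close>, written out
as polynomials in the entries of \<open>S\<close> and of \<open>y\<close>, so that measurability in \<open>S\<close> and continuity in \<open>y\<close> can be
read off.\<close>

definition dual_coord :: "nat \<Rightarrow> (nat \<Rightarrow> real) \<Rightarrow> nat \<Rightarrow> real mat \<Rightarrow> real" where
  "dual_coord q y i S = (\<Sum>l<m. A $$ (l, i) * (\<Sum>j<q. entry m q l j S * y j))"

definition dual_value :: "real vec \<Rightarrow> nat \<Rightarrow> (nat \<Rightarrow> real) \<Rightarrow> real mat \<Rightarrow> real" where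
  "dual_value h q y S = 2 * (\<Sum>i<n. dual_coord q y i S * h $ i) -
     (\<Sum>i<n. \<Sum>j<n. Binv $$ (i, j) * (dual_coord q y i S * dual_coord q y j S))"

lemma dual_value_eq:
  assumes S: "S \<in> carrier_mat m q" and h: "h \<in> carrier_vec n"
  shows "dual_value h q y S = 2 * (sketch_dual S (vec q y) \<bullet> h) -
    bform Binv (sketch_dual S (vec q y)) (sketch_dual S (vec q y))"
proof -
  have c: "sketch_dual S (vec q y) \<in> carrier_vec n" by (rule sketch_dual_carrier[OF S]) simp
  have "sketch_dual S (vec q y) $ i = dual_coord q y i S" if "i < n" for i
    using S A that
    by (auto simp: sketch_dual_def dual_coord_def entry_def scalar_prod_def atLeast0LessThan intro!: sum.cong)
  then show ?thesis
    using c h by (auto simp: dual_value_def bform_eq_sum[OF Binv(2) c c] scalar_prod_def atLeast0LessThan intro!: sum.cong)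
qed

lemma dual_value_measurable: "dual_value h q y \<in> borel_measurable (borel_mat m)"
proof -
  have *: "dual_coord q y i \<in> borel_measurable (borel_mat m)" for i
    unfolding dual_coord_def
    by (intro borel_measurable_sum borel_measurable_times borel_measurable_const entry_measurable) auto
  show ?thesis unfolding dual_value_def
    by (intro borel_measurable_diff borel_measurable_times borel_measurable_sum borel_measurable_const *)
qed

lemma dual_value_tendsto:
  assumes "\<And>j. j < q \<Longrightarrow> (\<lambda>r. Y r j) \<longlonglongrightarrow> y j"
  shows "(\<lambda>r. dual_value h q (Y r) S) \<longlonglongrightarrow> dual_value h q y S"
proof -
  have "(\<lambda>r. dual_coord q (Y r) i S) \<longlonglongrightarrow> dual_coord q y i S" for i
    unfolding dual_coord_def by (intro tendsto_intros assms) auto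
  then show ?thesis unfolding dual_value_def by (intro tendsto_intros)
qed

text \<open>A countable dense family of vectors: the pair \<open>(l, r)\<close> encodes the vector with coordinates
\<open>l ! j / (r + 1)\<close>.\<close>

definition grid :: "int list \<times> nat \<Rightarrow> nat \<Rightarrow> real" where
  "grid p j = real_of_int (fst p ! j) / real (Suc (snd p))"

text \<open>The maximiser \<open>y\<close> is approximated by vectors of the grid. A strict inequality survives this by continuity, so
countably many polynomial conditions describe the level set.\<close>

lemma less_bform_gram_iff:
  assumes S: "S \<in> carrier_mat m q" and h: "h \<in> carrier_vec n"
  shows "c < bform (gram S) h h \<longleftrightarrow> (\<exists>p. c < dual_value h q (grid p) S)"
proof
  assume "\<exists>p. c < dual_value h q (grid p) S"
  then obtain p where "c < dual_value h q (grid p) S" ..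
  also have "\<dots> \<le> bform (gram S) h h"
    unfolding dual_value_eq[OF S h] by (rule bform_gram_variational_le[OF S _ h]) simp
  finally show "c < bform (gram S) h h" .
next
  assume less: "c < bform (gram S) h h"
  obtain y where y: "y \<in> carrier_vec q"
    "2 * (sketch_dual S y \<bullet> h) - bform Binv (sketch_dual S y) (sketch_dual S y) = bform (gram S) h h"
    using bform_gram_variational_eq[OF S h] by auto
  have "vec q (($) y) = y" using y(1) by auto
  then have gap: "dual_value h q (($) y) S = bform (gram S) h h" by (simp only: dual_value_eq[OF S h] y(2))
  define p where "p r = (map (\<lambda>j. \<lfloor>y $ j * real (Suc r)\<rfloor>) [0..<q], r)" for r
  have "(\<lambda>r. grid (p r) j) \<longlonglongrightarrow> y $ j" if "j < q" for j
    using floor_quotient_tendsto[of "y $ j"] that by (simp add: grid_def p_def)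
  then have "(\<lambda>r. dual_value h q (grid (p r)) S) \<longlonglongrightarrow> dual_value h q (($) y) S"
    by (rule dual_value_tendsto)
  then have "\<forall>\<^sub>F r in sequentially. c < dual_value h q (grid (p r)) S"
    using less gap order_tendstoD(1) by metis
  then show "\<exists>p. c < dual_value h q (grid p) S"
    using eventually_happens'[OF sequentially_bot] by blast
qed

lemma bform_gram_measurable:
  assumes h: "h \<in> carrier_vec n"
  shows "(\<lambda>S. bform (gram S) h h) \<in> borel_measurable (borel_mat m)"
  unfolding borel_measurable_iff_greater
proof
  fix c :: real
  have "{S \<in> space (borel_mat m). c < bform (gram S) h h} =
    (\<Union>q. \<Union>p. carrier_mat m q \<inter> {S \<in> space (borel_mat m). c < dual_value h q (grid p) S})"
    (is "?L = ?R")
  proof (rule Set.set_eqI)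
    fix S
    show "S \<in> ?L \<longleftrightarrow> S \<in> ?R"
    proof (cases "dim_row S = m")
      case True
      then have S: "S \<in> carrier_mat m q \<longleftrightarrow> q = dim_col S" for q by auto
      have "c < bform (gram S) h h \<longleftrightarrow> (\<exists>p. c < dual_value h (dim_col S) (grid p) S)"
        by (rule less_bform_gram_iff[OF _ h]) (simp add: S)
      then show ?thesis using True by (simp add: space_borel_mat S)
    qed (simp add: space_borel_mat)
  qed
  also have "\<dots> \<in> sets (borel_mat m)"
    using dual_value_measurable[of h]
    by (intro sets.countable_UN sets.Int carrier_mat_in_sets_borel_mat image_subsetI)
      (unfold borel_measurable_iff_greater, blast)
  finally show "{S \<in> space (borel_mat m). c < bform (gram S) h h} \<in> sets (borel_mat m)" .
qed

text \<open>Polarization transfers measurability and boundedness from the quadratic form to the entries.\<close>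

lemma gram_entry_polarization:
  assumes "dim_row S = m" and ij: "i < n" "j < n"
  shows "gram S $$ (i, j) = (bform (gram S) (unit_vec n i + unit_vec n j) (unit_vec n i + unit_vec n j)
     - bform (gram S) (unit_vec n i) (unit_vec n i) - bform (gram S) (unit_vec n j) (unit_vec n j)) / 2"
proof -
  have S: "S \<in> carrier_mat m (dim_col S)" using assms by auto
  note G = gram_carrier[OF S]
  have c: "unit_vec n i \<in> carrier_vec n" "unit_vec n j \<in> carrier_vec n" by auto
  have "gram S $$ (i, j) = bform (gram S) (unit_vec n i) (unit_vec n j)"
    using G ij by (simp add: bform_def)
  then show ?thesis
    using c sym_psdD(2)[OF gram_sym_psd[OF S] c] by (simp add: bform_linear[OF G])
qed

end

section \<open>Bounded random variables\<close>

definition bounded_measurable :: "'a measure \<Rightarrow> ('a \<Rightarrow> real) set" where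
  "bounded_measurable M = {f \<in> borel_measurable M. \<exists>C. \<forall>x\<in>space M. \<bar>f x\<bar> \<le> C}"

lemma bounded_measurableI:
  "f \<in> borel_measurable M \<Longrightarrow> (\<And>x. x \<in> space M \<Longrightarrow> \<bar>f x\<bar> \<le> C) \<Longrightarrow> f \<in> bounded_measurable M"
  by (auto simp: bounded_measurable_def)

lemma bounded_measurable_const: "(\<lambda>x. c) \<in> bounded_measurable M"
  by (rule bounded_measurableI[where C = "\<bar>c\<bar>"]) auto

lemma bounded_measurable_add:
  assumes "f \<in> bounded_measurable M" "g \<in> bounded_measurable M"
  shows "(\<lambda>x. f x + g x) \<in> bounded_measurable M"
proof -
  obtain C C' where "\<And>x. x \<in> space M \<Longrightarrow> \<bar>f x\<bar> \<le> C" "\<And>x. x \<in> space M \<Longrightarrow> \<bar>g x\<bar> \<le> C'"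
    using assms by (auto simp: bounded_measurable_def)
  then have "\<bar>f x + g x\<bar> \<le> C + C'" if "x \<in> space M" for x using that by (smt (verit))
  then show ?thesis using assms by (intro bounded_measurableI) (auto simp: bounded_measurable_def)
qed

lemma bounded_measurable_mult:
  assumes "f \<in> bounded_measurable M" "g \<in> bounded_measurable M"
  shows "(\<lambda>x. f x * g x) \<in> bounded_measurable M"
proof -
  obtain C C' where C: "\<And>x. x \<in> space M \<Longrightarrow> \<bar>f x\<bar> \<le> C" "\<And>x. x \<in> space M \<Longrightarrow> \<bar>g x\<bar> \<le> C'"
    using assms by (auto simp: bounded_measurable_def)
  have "\<bar>f x * g x\<bar> \<le> C * C'" if "x \<in> space M" for x
    using C(1)[OF that] C(2)[OF that] by (simp add: abs_mult mult_mono')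
  then show ?thesis using assms by (intro bounded_measurableI) (auto simp: bounded_measurable_def)
qed

lemma bounded_measurable_diff:
  assumes "f \<in> bounded_measurable M" "g \<in> bounded_measurable M"
  shows "(\<lambda>x. f x - g x) \<in> bounded_measurable M"
  using bounded_measurable_add[OF assms(1) bounded_measurable_mult[OF bounded_measurable_const[of "-1"] assms(2)]]
  by simp

lemma bounded_measurable_sum:
  assumes "\<And>i. i \<in> I \<Longrightarrow> f i \<in> bounded_measurable M"
  shows "(\<lambda>x. \<Sum>i\<in>I. f i x) \<in> bounded_measurable M"
  using assms
  by (induction I rule: infinite_finite_induct)
     (auto intro: bounded_measurable_const bounded_measurable_add)

lemmas bounded_measurable_intros = bounded_measurable_const bounded_measurable_add
  bounded_measurable_diff bounded_measurable_mult bounded_measurable_sum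

lemma bounded_measurable_cong:
  assumes "\<And>x. x \<in> space M \<Longrightarrow> f x = g x"
  shows "f \<in> bounded_measurable M \<longleftrightarrow> g \<in> bounded_measurable M"
  using assms measurable_cong[of M f g borel] by (auto simp: bounded_measurable_def)

lemma bounded_measurable_compose:
  assumes "f \<in> bounded_measurable N" "T \<in> measurable M N"
  shows "(\<lambda>x. f (T x)) \<in> bounded_measurable M"
  using assms measurable_space[OF assms(2)] unfolding bounded_measurable_def by auto

lemma bounded_measurable_bform:
  assumes "\<And>x. x \<in> space M \<Longrightarrow> C x \<in> carrier_mat n n"
    and "\<And>x. x \<in> space M \<Longrightarrow> u x \<in> carrier_vec n" "\<And>x. x \<in> space M \<Longrightarrow> v x \<in> carrier_vec n"
    and "\<And>i j. i < n \<Longrightarrow> j < n \<Longrightarrow> (\<lambda>x. C x $$ (i, j)) \<in> bounded_measurable M"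
    and "\<And>i. i < n \<Longrightarrow> (\<lambda>x. u x $ i) \<in> bounded_measurable M"
    and "\<And>i. i < n \<Longrightarrow> (\<lambda>x. v x $ i) \<in> bounded_measurable M"
  shows "(\<lambda>x. bform (C x) (u x) (v x)) \<in> bounded_measurable M"
proof -
  have "(\<lambda>x. \<Sum>i<n. \<Sum>j<n. C x $$ (i, j) * (u x $ i * v x $ j)) \<in> bounded_measurable M"
    by (intro bounded_measurable_intros assms) auto
  then show ?thesis
    by (subst bounded_measurable_cong[OF bform_eq_sum]) (use assms(1-3) in auto)
qed

lemma (in prob_space) bounded_measurable_integrable:
  assumes f: "f \<in> bounded_measurable M"
  shows "integrable M f"
proof -
  obtain C where "\<And>x. x \<in> space M \<Longrightarrow> \<bar>f x\<bar> \<le> C" using f by (auto simp: bounded_measurable_def)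
  then show ?thesis
    using f by (intro integrable_const_bound[where B = C]) (auto simp: bounded_measurable_def)
qed

section \<open>The expected Gram matrix\<close>

locale random_sketch = sketched_system m n A B + D: prob_space D
  for m n :: nat and A B :: "real mat" and D :: "real mat measure" +
  assumes sets_D: "sets D = sets (borel_mat m)"
begin

lemma space_D: "S \<in> space D \<Longrightarrow> S \<in> carrier_mat m (dim_col S)"
  using sets_eq_imp_space_eq[OF sets_D] by (auto simp: space_borel_mat)

lemmas gram_sym_psd_D = gram_sym_psd[OF space_D]

lemmas sketch_f_eq_bform_D = sketch_f_eq_bform[OF space_D]

lemmas gram_carrier_D = gram_carrier[OF space_D]

lemma dim_row_D: "S \<in> space D \<Longrightarrow> dim_row S = m"
  using space_D by auto

lemma bform_gram_bounded_measurable: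
  assumes h: "h \<in> carrier_vec n"
  shows "(\<lambda>S. bform (gram S) h h) \<in> bounded_measurable D"
proof (rule bounded_measurableI[where C = "bform B h h"])
  show "(\<lambda>S. bform (gram S) h h) \<in> borel_measurable D"
    using bform_gram_measurable[OF h] measurable_cong_sets[OF sets_D refl] by auto
  fix S assume S: "S \<in> space D"
  show "\<bar>bform (gram S) h h\<bar> \<le> bform B h h"
    using gram_le_B[OF space_D[OF S] h] sym_psdD(3)[OF gram_sym_psd[OF space_D[OF S]] h] by simp
qed

lemma gram_entry_bounded_measurable:
  assumes "i < n" "j < n"
  shows "(\<lambda>S. gram S $$ (i, j)) \<in> bounded_measurable D"
proof -
  let ?q = "\<lambda>h S. bform (gram S) h h"
  have "(\<lambda>S. 1 / 2 * (?q (unit_vec n i + unit_vec n j) S - ?q (unit_vec n i) S - ?q (unit_vec n j) S))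
      \<in> bounded_measurable D"
    by (intro bounded_measurable_intros bform_gram_bounded_measurable) auto
  then show ?thesis
    using gram_entry_polarization[OF dim_row_D assms]
    by (subst bounded_measurable_cong[where g = "\<lambda>S. 1 / 2 * (?q (unit_vec n i + unit_vec n j) S - ?q (unit_vec n i) S - ?q (unit_vec n j) S)"])
      simp_all
qed

definition mean_gram :: "real mat" where
  "mean_gram = mat n n (\<lambda>(i, j). \<integral>S. gram S $$ (i, j) \<partial>D)"

lemma mean_gram_carrier: "mean_gram \<in> carrier_mat n n"
  by (simp add: mean_gram_def)

lemma bform_gram_has_integral:
  assumes u: "u \<in> carrier_vec n" and v: "v \<in> carrier_vec n"
  shows "integrable D (\<lambda>S. bform (gram S) u v)"
    and "(\<integral>S. bform (gram S) u v \<partial>D) = bform mean_gram u v"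
proof -
  have int: "integrable D (\<lambda>S. gram S $$ (i, j))" if "i < n" "j < n" for i j
    using D.bounded_measurable_integrable gram_entry_bounded_measurable that by blast
  show "integrable D (\<lambda>S. bform (gram S) u v)"
    by (intro D.bounded_measurable_integrable bounded_measurable_bform[where n = n] u v
        gram_carrier_D gram_entry_bounded_measurable bounded_measurable_const)
  have "(\<integral>S. bform (gram S) u v \<partial>D) = (\<integral>S. (\<Sum>i<n. \<Sum>j<n. gram S $$ (i, j) * (u $ i * v $ j)) \<partial>D)"
    by (intro Bochner_Integration.integral_cong refl bform_eq_sum u v gram_carrier_D)
  also have "\<dots> = (\<Sum>i<n. \<Sum>j<n. (\<integral>S. gram S $$ (i, j) \<partial>D) * (u $ i * v $ j))"
  proof -
    have int': "integrable D (\<lambda>S. gram S $$ (i, j) * (u $ i * v $ j))" if "i < n" "j < n" for i j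
      using int[OF that] by simp
    show ?thesis
    proof (subst Bochner_Integration.integral_sum)
      show "integrable D (\<lambda>S. \<Sum>j<n. gram S $$ (i, j) * (u $ i * v $ j))" if "i \<in> {..<n}" for i
        using int' that by (intro Bochner_Integration.integrable_sum) auto
      show "(\<Sum>i<n. \<integral>S. (\<Sum>j<n. gram S $$ (i, j) * (u $ i * v $ j)) \<partial>D) =
          (\<Sum>i<n. \<Sum>j<n. (\<integral>S. gram S $$ (i, j) \<partial>D) * (u $ i * v $ j))"
        using int int' by (intro sum.cong refl) (subst Bochner_Integration.integral_sum; auto)
    qed
  qed
  also have "\<dots> = bform mean_gram u v"
    by (simp add: bform_eq_sum[OF mean_gram_carrier u v]) (simp add: mean_gram_def)
  finally show "(\<integral>S. bform (gram S) u v \<partial>D) = bform mean_gram u v" .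
qed

lemma mean_gram_sym_psd: "sym_psd n mean_gram"
  unfolding sym_psd_def
proof (intro conjI ballI mean_gram_carrier)
  fix u v :: "real vec" assume c: "u \<in> carrier_vec n" "v \<in> carrier_vec n"
  show "bform mean_gram u v = bform mean_gram v u"
    unfolding bform_gram_has_integral(2)[OF c, symmetric] bform_gram_has_integral(2)[OF c(2,1), symmetric]
    by (intro Bochner_Integration.integral_cong refl sym_psdD(2)[OF gram_sym_psd_D c])
next
  fix u :: "real vec" assume c: "u \<in> carrier_vec n"
  show "0 \<le> bform mean_gram u u"
    unfolding bform_gram_has_integral(2)[OF c c, symmetric]
    by (intro Bochner_Integration.integral_nonneg sym_psdD(3)[OF gram_sym_psd_D c])
qed

lemma objective_eq_bform:
  assumes z: "z \<in> carrier_vec n" and x: "x \<in> carrier_vec n"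
  shows "objective D A B (A *\<^sub>v z) x = bform mean_gram (x - z) (x - z) / 2"
proof -
  have "objective D A B (A *\<^sub>v z) x = (\<integral>S. bform (gram S) (x - z) (x - z) / 2 \<partial>D)"
    unfolding objective_def
    by (intro Bochner_Integration.integral_cong refl sketch_f_eq_bform_D z x)
  then show ?thesis using bform_gram_has_integral(2)[of "x - z" "x - z"] x z by simp
qed

text \<open>A nonnegative function with vanishing mean is almost everywhere zero. This places the minimiser \<open>x\<close> in the solution set
of almost every sketched system, even if it does not solve \<open>A x = b\<close>.\<close>

lemma AE_gram_minimizer:
  assumes z: "z \<in> carrier_vec n" and x: "x \<in> carrier_vec n"
    and 0: "objective D A B (A *\<^sub>v z) x = 0"
  shows "AE S in D. gram S *\<^sub>v (x - z) = 0\<^sub>v n"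
proof -
  have e: "x - z \<in> carrier_vec n" using x z by simp
  have "(\<integral>S. bform (gram S) (x - z) (x - z) \<partial>D) = 0"
    using 0 bform_gram_has_integral(2)[OF e e] objective_eq_bform[OF z x] by simp
  moreover have "AE S in D. 0 \<le> bform (gram S) (x - z) (x - z)"
    by (intro AE_I2 sym_psdD(3)[OF gram_sym_psd_D e])
  ultimately have "AE S in D. bform (gram S) (x - z) (x - z) = 0"
    using integral_nonneg_eq_0_iff_AE[OF bform_gram_has_integral(1)[OF e e]] by simp
  moreover have "AE S in D. S \<in> space D" by simp
  ultimately show ?thesis
  proof eventually_elim
    case (elim S)
    then show ?case
      using bform_gram[OF space_D e e] bform_Binv_eq_0D[of "gram S *\<^sub>v (x - z)"]
        gram_carrier[OF space_D, of S] e by simp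
  qed
qed

end

section \<open>The deterministic step and averaging\<close>

lemma msgd_carrier:
  assumes "x0 \<in> carrier_vec n" "x1 \<in> carrier_vec n"
  shows "msgd A B b \<omega> \<beta> x0 x1 s k \<in> carrier_vec n"
proof (induction k rule: induct_nat_012)
  case (ge2 k)
  then show ?case by (intro carrier_vecI) simp
qed (use assms in auto)

lemma msgd_cong:
  assumes "\<And>i. 1 \<le> i \<Longrightarrow> i < k \<Longrightarrow> s i = s' i"
  shows "msgd A B b \<omega> \<beta> x0 x1 s k = msgd A B b \<omega> \<beta> x0 x1 s' k"
  using assms by (induction k rule: induct_nat_012) auto

lemma cesaro_avg:
  assumes "\<And>t. x t \<in> carrier_vec n"
  shows cesaro_avg_carrier: "cesaro_avg n x k \<in> carrier_vec n"
    and cesaro_avg_index: "i < n \<Longrightarrow> cesaro_avg n x k $ i = (1 / real k) * (\<Sum>t=1..k. x t $ i)"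
proof -
  have c: "finsum_vec TYPE(real) n x {1..k} \<in> carrier_vec n"
    using assms by (intro finsum_vec_closed) auto
  then show "cesaro_avg n x k \<in> carrier_vec n" by (simp add: cesaro_avg_def)
  show "cesaro_avg n x k $ i = (1 / real k) * (\<Sum>t=1..k. x t $ i)" if "i < n"
    using c that assms index_finsum_vec[of "{1..k}" i n x] by (simp add: cesaro_avg_def)
qed

text \<open>Jensen's inequality for a convex quadratic: the tangent inequality at the average, summed over the points, loses its linear part.\<close>

lemma bform_cesaro_avg_le:
  assumes C: "sym_psd n C" and x: "\<And>t. x t \<in> carrier_vec n" and z: "z \<in> carrier_vec n"
    and k: "k \<ge> 1"
  shows "bform C (cesaro_avg n x k - z) (cesaro_avg n x k - z) \<le>
    (1 / real k) * (\<Sum>t=1..k. bform C (x t - z) (x t - z))"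
proof -
  define a where "a = cesaro_avg n x k"
  define v where "v = a - z"
  have a: "a \<in> carrier_vec n" using cesaro_avg_carrier[OF x] by (simp add: a_def)
  have v: "v \<in> carrier_vec n" using a z by (simp add: v_def)
  note Cc = sym_psdD(1)[OF C]
  have tangent: "bform C v v + 2 * bform C v (x t - a) \<le> bform C (x t - z) (x t - z)" for t
  proof -
    have "(x t - z) - v = x t - a" using x[of t] a z by (intro eq_vecI) (auto simp: v_def)
    then show ?thesis using sym_psd_tangent_le[OF C, of "x t - z" v] x[of t] z v by simp
  qed
  have "(\<Sum>t=1..k. bform C v (x t - a)) = (\<Sum>t=1..k. \<Sum>i<n. (x t $ i - a $ i) * (C *\<^sub>v v) $ i)"
  proof (intro sum.cong refl)
    fix t
    have "bform C v (x t - a) = bform C (x t - a) v" using sym_psdD(2)[OF C] x[of t] a v by simp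
    also have "\<dots> = (\<Sum>i<n. (x t $ i - a $ i) * (C *\<^sub>v v) $ i)"
      using a x[of t] Cc unfolding bform_def scalar_prod_def
      by (auto simp: atLeast0LessThan intro!: sum.cong)
    finally show "bform C v (x t - a) = (\<Sum>i<n. (x t $ i - a $ i) * (C *\<^sub>v v) $ i)" .
  qed
  also have "\<dots> = (\<Sum>i<n. (\<Sum>t=1..k. x t $ i - a $ i) * (C *\<^sub>v v) $ i)"
    by (subst sum.swap) (simp add: sum_distrib_right)
  also have "\<dots> = 0"
    using cesaro_avg_index[OF x, where k = k] k by (simp add: sum_subtractf a_def)
  finally have "(\<Sum>t=1..k. bform C v v + 2 * bform C v (x t - a)) = real k * bform C v v"
    by (simp add: sum.distrib flip: sum_distrib_left)
  moreover have "(\<Sum>t=1..k. bform C v v + 2 * bform C v (x t - a)) \<le> (\<Sum>t=1..k. bform C (x t - z) (x t - z))"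
    by (intro sum_mono tangent)
  ultimately show ?thesis using k by (simp add: field_simps flip: a_def v_def)
qed

text \<open>The shift \<open>V\<close> satisfies \<open>V' = V - \<omega> g\<close>, so the only cross term of the expanded square is \<open>V \<bullet> G e'\<close>, where \<open>e' = x' - z\<close>. In
\<open>V \<bullet> G e'\<close> the component along \<open>y - z\<close> vanishes by \<open>min\<close>, and the mixed term of the last
two iterates is bounded by convexity, at the price of the telescoping difference of objective values.\<close>

lemma (in sketched_system) momentum_step_le:
  assumes S: "S \<in> carrier_mat m q"
    and z: "z \<in> carrier_vec n" and x: "x \<in> carrier_vec n" and x': "x' \<in> carrier_vec n"
    and y: "y \<in> carrier_vec n" and min: "gram S *\<^sub>v (y - z) = 0\<^sub>v n"
    and pos: "0 \<le> \<omega>" "0 \<le> \<beta>"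
    and x'': "x'' = x' - \<omega> \<cdot>\<^sub>v sketch_grad A B (A *\<^sub>v z) S x' + \<beta> \<cdot>\<^sub>v (x' - x)"
  defines "V \<equiv> x' - \<beta> \<cdot>\<^sub>v x - (1 - \<beta>) \<cdot>\<^sub>v y" and "V' \<equiv> x'' - \<beta> \<cdot>\<^sub>v x' - (1 - \<beta>) \<cdot>\<^sub>v y"
  shows "bform B V' V' \<le> bform B V V
    - 2 * \<omega> * (2 - 2 * \<beta> - \<omega>) * sketch_f A B (A *\<^sub>v z) S x'
    - 2 * \<omega> * \<beta> * (sketch_f A B (A *\<^sub>v z) S x' - sketch_f A B (A *\<^sub>v z) S x)"
proof -
  note G = gram_sym_psd[OF S]
  note Gc = gram_carrier[OF S]
  define Q where "Q = bform (gram S)"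
  define e e' d where "e = x - z" and "e' = x' - z" and "d = y - z"
  define g where "g = Binv *\<^sub>v (gram S *\<^sub>v e')"
  have c: "e \<in> carrier_vec n" "e' \<in> carrier_vec n" "d \<in> carrier_vec n"
    using z x x' y by (auto simp: e_def e'_def d_def)
  have Ge: "gram S *\<^sub>v e' \<in> carrier_vec n" using Gc c by simp
  have g: "g \<in> carrier_vec n" using Binv Ge by (simp add: g_def)
  have grad: "sketch_grad A B (A *\<^sub>v z) S x' = g"
    by (simp add: sketch_grad_eq[OF S z x'] g_def e'_def)
  have V: "V \<in> carrier_vec n" using x x' y by (simp add: V_def)
  have V'_eq: "V' = V - \<omega> \<cdot>\<^sub>v g"
    using x x' y g unfolding V'_def V_def x'' grad by (intro eq_vecI) (auto simp: algebra_simps)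
  have V_eq: "V = (e' - \<beta> \<cdot>\<^sub>v e) - (1 - \<beta>) \<cdot>\<^sub>v d"
    using x x' y z unfolding V_def e_def e'_def d_def by (intro eq_vecI) (auto simp: algebra_simps)
  have Qd: "Q d e' = 0"
    using sym_psdD(2)[OF G c(3,2)] min c by (simp add: Q_def) (simp add: bform_def d_def)
  have Bg: "bform B u g = Q u e'" if "u \<in> carrier_vec n" for u
    using Ge by (simp add: Q_def bform_def g_def B_Binv_vec)
  have QV: "Q V e' = Q e' e' - \<beta> * Q e e'"
    using c Qd unfolding V_eq Q_def by (simp add: bform_linear[OF Gc])
  have gg: "bform B g g = Q e' e'"
    using Ge c by (simp add: g_def bform_Binv[symmetric] bform_gram[OF S, symmetric] Q_def)
  \<comment> \<open>The tangent at e', evaluated at e.\<close>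
  have "2 * Q e e' \<le> Q e' e' + Q e e"
  proof -
    have "Q e' (e - e') = Q e e' - Q e' e'"
      using c sym_psdD(2)[OF G c(1,2)] by (simp add: Q_def bform_linear[OF Gc])
    then show ?thesis using sym_psd_tangent_le[OF G c(1,2)] by (simp add: Q_def)
  qed
  then have convex: "\<omega> * \<beta> * (2 * Q e e') \<le> \<omega> * \<beta> * (Q e' e' + Q e e)"
    using pos by (intro mult_left_mono) auto
  have "bform B V' V' = bform B V V - 2 * \<omega> * bform B V g + \<omega>\<^sup>2 * bform B g g"
    using V g sym_psdD(2)[OF B_sym_psd V g] unfolding V'_eq
    by (simp add: bform_linear[OF B_carrier] power2_eq_square algebra_simps)
  also have "\<dots> = bform B V V - 2 * \<omega> * Q e' e' + \<omega> * \<beta> * (2 * Q e e') + \<omega>\<^sup>2 * Q e' e'"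
    by (simp add: Bg[OF V] QV gg algebra_simps)
  also have "\<dots> \<le> bform B V V - 2 * \<omega> * (2 - 2 * \<beta> - \<omega>) * (Q e' e' / 2)
      - 2 * \<omega> * \<beta> * (Q e' e' / 2 - Q e e / 2)"
    using convex by (simp add: algebra_simps power2_eq_square)
  finally show ?thesis
    by (simp add: sketch_f_eq_bform[OF S z x] sketch_f_eq_bform[OF S z x'] Q_def e_def e'_def)
qed

section \<open>The random iterates\<close>

text \<open>The factorisation behind conditioning on the past: a function of \<open>X t\<close> and a function of the earlier variables are
uncorrelated.\<close>

lemma (in prob_space) expectation_mult_past_present:
  fixes X :: "nat \<Rightarrow> 'a \<Rightarrow> 'b"
  assumes indep: "indep_vars (\<lambda>_. N) X {1..}" and t: "1 \<le> t"
    and F: "F \<in> bounded_measurable (PiM {1..<t} (\<lambda>_. N))" and H: "H \<in> bounded_measurable N"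
  shows "expectation (\<lambda>w. H (X t w) * F (\<lambda>i\<in>{1..<t}. X i w)) =
    expectation (\<lambda>w. H (X t w)) * expectation (\<lambda>w. F (\<lambda>i\<in>{1..<t}. X i w))"
    (is "?L = ?R")
proof -
  have "indep_var (PiM {t} (\<lambda>_. N)) (\<lambda>w. \<lambda>i\<in>{t}. X i w) (PiM {1..<t} (\<lambda>_. N)) (\<lambda>w. \<lambda>i\<in>{1..<t}. X i w)"
    using t by (intro indep_var_restrict[OF indep]) auto
  moreover have "(\<lambda>f. H (f t)) \<in> borel_measurable (PiM {t} (\<lambda>_. N))"
    using H by (intro measurable_compose[OF measurable_component_singleton]) (auto simp: bounded_measurable_def)
  moreover have "F \<in> borel_measurable (PiM {1..<t} (\<lambda>_. N))"
    using F by (simp add: bounded_measurable_def)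
  ultimately have ind: "indep_var borel ((\<lambda>f. H (f t)) \<circ> (\<lambda>w. \<lambda>i\<in>{t}. X i w)) borel (F \<circ> (\<lambda>w. \<lambda>i\<in>{1..<t}. X i w))"
    by (rule indep_var_compose)
  have Xt: "X t \<in> measurable M N" using indep t by (auto simp: indep_vars_def)
  have past: "(\<lambda>w. \<lambda>i\<in>{1..<t}. X i w) \<in> measurable M (PiM {1..<t} (\<lambda>_. N))"
    using indep by (intro measurable_restrict) (auto simp: indep_vars_def)
  show ?thesis
    using indep_var_lebesgue_integral[OF ind]
      bounded_measurable_integrable[OF bounded_measurable_compose[OF H Xt]]
      bounded_measurable_integrable[OF bounded_measurable_compose[OF F past]]
    by (simp add: comp_def)
qed

locale momentum_process = random_sketch m n A B D + P: prob_space \<Omega>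
  for m n :: nat and A B :: "real mat" and D :: "real mat measure" and \<Omega> :: "'w measure" +
  fixes S :: "nat \<Rightarrow> 'w \<Rightarrow> real mat" and z x0 :: "real vec" and \<omega> \<beta> :: real
  assumes indep: "P.indep_vars (\<lambda>_. D) S {1..}"
    and distr: "\<And>i. i \<ge> 1 \<Longrightarrow> distr \<Omega> D (S i) = D"
    and z: "z \<in> carrier_vec n" and x0: "x0 \<in> carrier_vec n"
begin

text \<open>The iterate as a function of the sequence of sketches. Keeping that sequence as an argument shows that \<open>X k\<close> depends on the
sketches with index below \<open>k\<close> only.\<close>

definition iter :: "(nat \<Rightarrow> real mat) \<Rightarrow> nat \<Rightarrow> real vec" where
  "iter = msgd A B (A *\<^sub>v z) \<omega> \<beta> x0 x0"

definition X :: "nat \<Rightarrow> 'w \<Rightarrow> real vec" where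
  "X k w = iter (\<lambda>i. S i w) k"

lemma iter_carrier: "iter s k \<in> carrier_vec n"
  unfolding iter_def by (intro msgd_carrier x0)

lemma X_carrier: "X k w \<in> carrier_vec n"
  unfolding X_def by (rule iter_carrier)

lemma S_measurable: "1 \<le> t \<Longrightarrow> S t \<in> measurable \<Omega> D"
  using indep by (auto simp: P.indep_vars_def)

lemma past_measurable: "(\<lambda>w. \<lambda>i\<in>{1..<t}. S i w) \<in> measurable \<Omega> (PiM {1..<t} (\<lambda>_. D))"
  by (intro measurable_restrict S_measurable) auto

text \<open>Each step is affine in the last two iterates, with coefficients built from the entries of \<open>gram\<close>, which are bounded uniformly
in the sketch. Boundedness of the starting point therefore propagates.\<close>

lemma iter_bounded_measurable:
  assumes "k \<le> t" "i < n"
  shows "(\<lambda>s. iter s k $ i) \<in> bounded_measurable (PiM {1..<t} (\<lambda>_. D))"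
  using assms
proof (induction k arbitrary: i rule: induct_nat_012)
  case (ge2 k)
  have sk: "Suc k \<in> {1..<t}" using ge2.prems by simp
  have s: "s (Suc k) \<in> space D" if "s \<in> space (PiM {1..<t} (\<lambda>_. D))" for s
    using that sk by (auto simp: space_PiM)
  have gram: "(\<lambda>s. gram (s (Suc k)) $$ (j, l)) \<in> bounded_measurable (PiM {1..<t} (\<lambda>_. D))"
    if "j < n" "l < n" for j l
    by (intro bounded_measurable_compose[OF gram_entry_bounded_measurable] that measurable_component_singleton sk)
  let ?g = "\<lambda>s. \<Sum>j<n. Binv $$ (i, j) * (\<Sum>l<n. gram (s (Suc k)) $$ (j, l) * (iter s (Suc k) $ l - z $ l))"
  have step: "iter s (Suc (Suc k)) $ i =
      iter s (Suc k) $ i - \<omega> * ?g s + \<beta> * (iter s (Suc k) $ i - iter s k $ i)"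
    if "s \<in> space (PiM {1..<t} (\<lambda>_. D))" for s
  proof -
    note G = gram_carrier_D[OF s[OF that]]
    note c = iter_carrier[of s "Suc k"] iter_carrier[of s k]
    have "sketch_grad A B (A *\<^sub>v z) (s (Suc k)) (iter s (Suc k)) =
        Binv *\<^sub>v (gram (s (Suc k)) *\<^sub>v (iter s (Suc k) - z))"
      by (rule sketch_grad_eq[OF space_D[OF s[OF that]] z c(1)])
    moreover have "(Binv *\<^sub>v (gram (s (Suc k)) *\<^sub>v (iter s (Suc k) - z))) $ i = ?g s"
      using ge2.prems Binv(2) G c z by (auto simp: scalar_prod_def atLeast0LessThan intro!: sum.cong)
    moreover have "iter s (Suc (Suc k)) = iter s (Suc k)
        - \<omega> \<cdot>\<^sub>v sketch_grad A B (A *\<^sub>v z) (s (Suc k)) (iter s (Suc k)) + \<beta> \<cdot>\<^sub>v (iter s (Suc k) - iter s k)"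
      by (simp add: iter_def)
    ultimately show ?thesis
      using ge2.prems c Binv(2) by simp
  qed
  have "(\<lambda>s. iter s (Suc k) $ i - \<omega> * ?g s + \<beta> * (iter s (Suc k) $ i - iter s k $ i))
      \<in> bounded_measurable (PiM {1..<t} (\<lambda>_. D))"
    using ge2 by (intro bounded_measurable_intros gram) auto
  then show ?case
    by (subst bounded_measurable_cong[OF step])
qed (auto simp: iter_def bounded_measurable_const)

lemma X_eq_past: "k \<le> t \<Longrightarrow> X k w = iter (\<lambda>i\<in>{1..<t}. S i w) k"
  unfolding X_def iter_def by (intro msgd_cong) auto

lemma X_bounded_measurable:
  assumes "i < n"
  shows "(\<lambda>w. X k w $ i) \<in> bounded_measurable \<Omega>"
  using bounded_measurable_compose[OF iter_bounded_measurable[OF order.refl assms] past_measurable, of k]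
  by (simp add: X_eq_past[OF order.refl])

lemma bform_X_bounded_measurable:
  assumes "C \<in> carrier_mat n n"
  shows "(\<lambda>w. bform C (X k w - z) (X k w - z)) \<in> bounded_measurable \<Omega>"
proof (rule bounded_measurable_bform[where n = n])
  show "(\<lambda>w. (X k w - z) $ i) \<in> bounded_measurable \<Omega>" if "i < n" for i
    using bounded_measurable_diff[OF X_bounded_measurable[OF that] bounded_measurable_const, of k "z $ i"] z that
    by simp
  then show "(\<lambda>w. (X k w - z) $ i) \<in> bounded_measurable \<Omega>" if "i < n" for i using that .
qed (use assms X_carrier z in \<open>auto intro: bounded_measurable_const\<close>)

text \<open>Conditioning on the past without conditional expectations: the quadratic form is a sum of products of an entry of \<open>gram (S t)\<close>
and a bounded function of the earlier sketches, and the expectation of each product factorises.\<close>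

lemma sketch_f_X:
  assumes t: "1 \<le> t" and kt: "k \<le> t"
  shows integrable_sketch_f_X: "integrable \<Omega> (\<lambda>w. sketch_f A B (A *\<^sub>v z) (S t w) (X k w))"
    and expectation_sketch_f_X: "P.expectation (\<lambda>w. sketch_f A B (A *\<^sub>v z) (S t w) (X k w)) =
      P.expectation (\<lambda>w. objective D A B (A *\<^sub>v z) (X k w))"
proof -
  define e where "e w i = X k w $ i - z $ i" for w i
  have St: "S t w \<in> space D" if "w \<in> space \<Omega>" for w
    using measurable_space[OF S_measurable[OF t] that] .
  have e_bm: "(\<lambda>w. e w i) \<in> bounded_measurable \<Omega>" if "i < n" for i
    unfolding e_def by (intro bounded_measurable_intros X_bounded_measurable that)
  have G_bm: "(\<lambda>w. gram (S t w) $$ (i, j)) \<in> bounded_measurable \<Omega>" if "i < n" "j < n" for i j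
    by (intro bounded_measurable_compose[OF gram_entry_bounded_measurable S_measurable] that t)
  have bform_e: "bform C (X k w - z) (X k w - z) = (\<Sum>i<n. \<Sum>j<n. C $$ (i, j) * (e w i * e w j))"
    if "C \<in> carrier_mat n n" for C w
    using X_carrier[of k w] z by (subst bform_eq_sum[OF that]) (auto simp: e_def intro!: sum.cong)
  have f_eq: "sketch_f A B (A *\<^sub>v z) (S t w) (X k w) =
      (\<Sum>i<n. \<Sum>j<n. gram (S t w) $$ (i, j) * (e w i * e w j)) / 2" if "w \<in> space \<Omega>" for w
    using sketch_f_eq_bform_D[OF St[OF that] z X_carrier] bform_e gram_carrier_D[OF St[OF that]] by simp
  have bm: "(\<lambda>w. gram (S t w) $$ (i, j) * (e w i * e w j)) \<in> bounded_measurable \<Omega>"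
    if "i < n" "j < n" for i j
    by (intro bounded_measurable_intros G_bm e_bm that)
  have int_ij: "integrable \<Omega> (\<lambda>w. gram (S t w) $$ (i, j) * (e w i * e w j))"
    "integrable \<Omega> (\<lambda>w. e w i * e w j)" if "i < n" "j < n" for i j
    by (intro P.bounded_measurable_integrable bm bounded_measurable_mult e_bm that)+
  have int_i: "integrable \<Omega> (\<lambda>w. \<Sum>j<n. gram (S t w) $$ (i, j) * (e w i * e w j))"
     "integrable \<Omega> (\<lambda>w. \<Sum>j<n. mean_gram $$ (i, j) * (e w i * e w j))" if "i < n" for i
    using int_ij that by (auto intro!: Bochner_Integration.integrable_sum)
  have "integrable \<Omega> (\<lambda>w. (\<Sum>i<n. \<Sum>j<n. gram (S t w) $$ (i, j) * (e w i * e w j)) / 2)"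
    by (intro Bochner_Integration.integrable_divide Bochner_Integration.integrable_sum int_i(1)) simp
  then show "integrable \<Omega> (\<lambda>w. sketch_f A B (A *\<^sub>v z) (S t w) (X k w))"
    by (subst Bochner_Integration.integrable_cong[OF refl f_eq])
  have split: "P.expectation (\<lambda>w. gram (S t w) $$ (i, j) * (e w i * e w j)) =
      mean_gram $$ (i, j) * P.expectation (\<lambda>w. e w i * e w j)" if ij: "i < n" "j < n" for i j
  proof -
    let ?F = "\<lambda>s. (iter s k $ i - z $ i) * (iter s k $ j - z $ j)"
    have F: "?F \<in> bounded_measurable (PiM {1..<t} (\<lambda>_. D))"
      by (intro bounded_measurable_intros iter_bounded_measurable kt ij)
    have "P.expectation (\<lambda>w. gram (S t w) $$ (i, j) * (e w i * e w j)) =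
      P.expectation (\<lambda>w. gram (S t w) $$ (i, j)) * P.expectation (\<lambda>w. e w i * e w j)"
      using P.expectation_mult_past_present[OF indep t F gram_entry_bounded_measurable[OF ij]]
      by (simp add: e_def X_eq_past[OF kt])
    also have "P.expectation (\<lambda>w. gram (S t w) $$ (i, j)) = (\<integral>M. gram M $$ (i, j) \<partial>distr \<Omega> D (S t))"
      using gram_entry_bounded_measurable[OF ij]
      by (intro integral_distr[symmetric] S_measurable t) (auto simp: bounded_measurable_def)
    also have "\<dots> = mean_gram $$ (i, j)" using ij by (simp add: distr[OF t] mean_gram_def)
    finally show ?thesis .
  qed
  have "P.expectation (\<lambda>w. sketch_f A B (A *\<^sub>v z) (S t w) (X k w)) =
      P.expectation (\<lambda>w. (\<Sum>i<n. \<Sum>j<n. gram (S t w) $$ (i, j) * (e w i * e w j)) / 2)"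
    by (intro Bochner_Integration.integral_cong refl f_eq)
  also have "\<dots> = (\<Sum>i<n. \<Sum>j<n. P.expectation (\<lambda>w. gram (S t w) $$ (i, j) * (e w i * e w j))) / 2"
    using int_i int_ij by (simp add: Bochner_Integration.integral_sum)
  also have "\<dots> = (\<Sum>i<n. \<Sum>j<n. mean_gram $$ (i, j) * P.expectation (\<lambda>w. e w i * e w j)) / 2"
    using split by simp
  also have "\<dots> = P.expectation (\<lambda>w. (\<Sum>i<n. \<Sum>j<n. mean_gram $$ (i, j) * (e w i * e w j)) / 2)"
    using int_i int_ij by (simp add: Bochner_Integration.integral_sum)
  also have "\<dots> = P.expectation (\<lambda>w. objective D A B (A *\<^sub>v z) (X k w))"
    by (simp add: objective_eq_bform[OF z X_carrier] bform_e[OF mean_gram_carrier])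
  finally show "P.expectation (\<lambda>w. sketch_f A B (A *\<^sub>v z) (S t w) (X k w)) =
      P.expectation (\<lambda>w. objective D A B (A *\<^sub>v z) (X k w))" .
qed

definition mean_obj :: "nat \<Rightarrow> real" where
  "mean_obj k = P.expectation (\<lambda>w. objective D A B (A *\<^sub>v z) (X k w))"

lemma integrable_objective_X: "integrable \<Omega> (\<lambda>w. objective D A B (A *\<^sub>v z) (X k w))"
  using P.bounded_measurable_integrable[OF bform_X_bounded_measurable[OF mean_gram_carrier]]
  by (simp add: objective_eq_bform[OF z X_carrier])

lemma mean_obj_nonneg: "0 \<le> mean_obj k"
  unfolding mean_obj_def
  using sym_psdD(3)[OF mean_gram_sym_psd] X_carrier z
  by (intro Bochner_Integration.integral_nonneg) (simp add: objective_eq_bform[OF z X_carrier])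

text \<open>The vector \<open>V\<close> of \<open>momentum_step_le\<close> with \<open>x' = X (t + 1)\<close> and \<open>x = X t\<close>, so that \<open>t = 0\<close> is the
starting pair.\<close>

definition shifted_iterate :: "real vec \<Rightarrow> nat \<Rightarrow> 'w \<Rightarrow> real vec" where
  "shifted_iterate y t w = X (Suc t) w - \<beta> \<cdot>\<^sub>v X t w - (1 - \<beta>) \<cdot>\<^sub>v y"

definition potential :: "real vec \<Rightarrow> nat \<Rightarrow> real" where
  "potential y t = P.expectation (\<lambda>w. bform B (shifted_iterate y t w) (shifted_iterate y t w))"

lemma shifted_iterate_carrier: "y \<in> carrier_vec n \<Longrightarrow> shifted_iterate y t w \<in> carrier_vec n"
  using X_carrier by (simp add: shifted_iterate_def)

lemma potential_nonneg: "y \<in> carrier_vec n \<Longrightarrow> 0 \<le> potential y t"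
  unfolding potential_def
  by (intro Bochner_Integration.integral_nonneg sym_psdD(3)[OF B_sym_psd] shifted_iterate_carrier)

lemma integrable_potential:
  assumes y: "y \<in> carrier_vec n"
  shows "integrable \<Omega> (\<lambda>w. bform B (shifted_iterate y t w) (shifted_iterate y t w))"
proof (intro P.bounded_measurable_integrable bounded_measurable_bform[where n = n])
  have "(\<lambda>w. shifted_iterate y t w $ i) \<in> bounded_measurable \<Omega>" if "i < n" for i
  proof -
    have "(\<lambda>w. X (Suc t) w $ i - \<beta> * X t w $ i - (1 - \<beta>) * y $ i) \<in> bounded_measurable \<Omega>"
      by (intro bounded_measurable_intros X_bounded_measurable that)
    then show ?thesis
      using carrier_vecD[OF X_carrier] y that by (simp add: shifted_iterate_def)
  qed
  then show "\<And>i. i < n \<Longrightarrow> (\<lambda>w. shifted_iterate y t w $ i) \<in> bounded_measurable \<Omega>"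
    "\<And>i. i < n \<Longrightarrow> (\<lambda>w. shifted_iterate y t w $ i) \<in> bounded_measurable \<Omega>" by auto
qed (use B_carrier shifted_iterate_carrier[OF y] in \<open>auto intro: bounded_measurable_const\<close>)

lemma potential_step:
  assumes y: "y \<in> carrier_vec n" and min: "objective D A B (A *\<^sub>v z) y = 0"
    and pos: "0 \<le> \<omega>" "0 \<le> \<beta>"
  shows "potential y (Suc t) \<le> potential y t - 2 * \<omega> * (2 - 2 * \<beta> - \<omega>) * mean_obj (Suc t)
    - 2 * \<omega> * \<beta> * (mean_obj (Suc t) - mean_obj t)"
proof -
  let ?f = "\<lambda>k w. sketch_f A B (A *\<^sub>v z) (S (Suc t) w) (X k w)"
  let ?q = "\<lambda>t w. bform B (shifted_iterate y t w) (shifted_iterate y t w)"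
  have int: "integrable \<Omega> (?f (Suc t))" "integrable \<Omega> (?f t)"
    by (intro integrable_sketch_f_X; simp)+
  have "AE M in distr \<Omega> D (S (Suc t)). gram M *\<^sub>v (y - z) = 0\<^sub>v n"
    by (subst distr) (simp, rule AE_gram_minimizer[OF z y min])
  then have "AE w in \<Omega>. gram (S (Suc t) w) *\<^sub>v (y - z) = 0\<^sub>v n"
    by (rule AE_distrD[rotated]) (simp add: S_measurable)
  moreover have "AE w in \<Omega>. w \<in> space \<Omega>" by simp
  ultimately have step: "AE w in \<Omega>. ?q (Suc t) w \<le> ?q t w - 2 * \<omega> * (2 - 2 * \<beta> - \<omega>) * ?f (Suc t) w
    - 2 * \<omega> * \<beta> * (?f (Suc t) w - ?f t w)"
  proof eventually_elim
    case (elim w)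
    have "S (Suc t) w \<in> space D" using measurable_space[OF S_measurable elim(2)] by simp
    then show ?case
      unfolding shifted_iterate_def
      by (intro momentum_step_le[OF space_D z X_carrier X_carrier y elim(1) pos])
        (simp_all add: X_def iter_def)
  qed
  have "potential y (Suc t) \<le> P.expectation (\<lambda>w. ?q t w - 2 * \<omega> * (2 - 2 * \<beta> - \<omega>) * ?f (Suc t) w
    - 2 * \<omega> * \<beta> * (?f (Suc t) w - ?f t w))"
    unfolding potential_def
    using int integrable_potential[OF y] step by (intro integral_mono_AE) auto
  also have "\<dots> = potential y t - 2 * \<omega> * (2 - 2 * \<beta> - \<omega>) * P.expectation (?f (Suc t))
    - 2 * \<omega> * \<beta> * (P.expectation (?f (Suc t)) - P.expectation (?f t))"
    using int integrable_potential[OF y] by (simp add: potential_def)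
  also have "P.expectation (?f (Suc t)) = mean_obj (Suc t)"
    unfolding mean_obj_def by (rule expectation_sketch_f_X) auto
  also have "P.expectation (?f t) = mean_obj t"
    unfolding mean_obj_def by (rule expectation_sketch_f_X) auto
  finally show ?thesis .
qed

text \<open>Telescoping. The term \<open>2 \<omega> \<beta> f\<close> is carried along with the potential, which is why the value at the starting
point survives in the bound; the two equal starting points make the initial shifted vector a multiple of \<open>x0 - y\<close>.\<close>

lemma sum_mean_obj_le:
  assumes y: "y \<in> carrier_vec n" and min: "objective D A B (A *\<^sub>v z) y = 0"
    and pos: "0 \<le> \<omega>" "0 \<le> \<beta>"
  shows "2 * \<omega> * (2 - 2 * \<beta> - \<omega>) * (\<Sum>t=1..k. mean_obj t) \<le>
    (1 - \<beta>)\<^sup>2 * bform B (x0 - y) (x0 - y) + 2 * \<omega> * \<beta> * objective D A B (A *\<^sub>v z) x0"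
proof -
  have sum: "potential y k + 2 * \<omega> * \<beta> * mean_obj k + 2 * \<omega> * (2 - 2 * \<beta> - \<omega>) * (\<Sum>t=1..k. mean_obj t)
    \<le> potential y 0 + 2 * \<omega> * \<beta> * mean_obj 0"
  proof (induction k)
    case (Suc k)
    then show ?case using potential_step[OF assms, of k] by (simp add: algebra_simps)
  qed simp
  have "shifted_iterate y 0 w = (1 - \<beta>) \<cdot>\<^sub>v (x0 - y)" for w
    using x0 y by (intro eq_vecI) (auto simp: shifted_iterate_def X_def iter_def algebra_simps)
  then have pot0: "potential y 0 = (1 - \<beta>)\<^sup>2 * bform B (x0 - y) (x0 - y)"
    using x0 y by (simp add: potential_def bform_smult_left[OF B_carrier] bform_smult_right[OF B_carrier] power2_eq_square P.prob_space)
  have obj0: "mean_obj 0 = objective D A B (A *\<^sub>v z) x0"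
    by (simp add: mean_obj_def X_def iter_def P.prob_space)
  have "0 \<le> potential y k + 2 * \<omega> * \<beta> * mean_obj k"
    using potential_nonneg[OF y] mean_obj_nonneg pos by simp
  then show ?thesis using sum unfolding pot0 obj0 by linarith
qed

lemma objective_cesaro_avg:
  assumes k: "k \<ge> 1"
  defines "xhat \<equiv> \<lambda>w. cesaro_avg n (\<lambda>t. X t w) k"
  shows integrable_objective_cesaro: "integrable \<Omega> (\<lambda>w. objective D A B (A *\<^sub>v z) (xhat w))"
    and expectation_objective_cesaro: "P.expectation (\<lambda>w. objective D A B (A *\<^sub>v z) (xhat w))
      \<le> (1 / real k) * (\<Sum>t=1..k. mean_obj t)"
proof -
  have xhat: "xhat w \<in> carrier_vec n" for w
    unfolding xhat_def by (intro cesaro_avg_carrier X_carrier)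
  have "(\<lambda>w. bform mean_gram (xhat w - z) (xhat w - z)) \<in> bounded_measurable \<Omega>"
  proof (rule bounded_measurable_bform[where n = n])
    have "(\<lambda>w. (xhat w - z) $ i) \<in> bounded_measurable \<Omega>" if "i < n" for i
    proof -
      have "(\<lambda>w. 1 / real k * (\<Sum>t=1..k. X t w $ i) - z $ i) \<in> bounded_measurable \<Omega>"
        by (intro bounded_measurable_intros X_bounded_measurable that)
      then show ?thesis using that z by (simp add: xhat_def cesaro_avg_index[OF X_carrier])
    qed
    then show "\<And>i. i < n \<Longrightarrow> (\<lambda>w. (xhat w - z) $ i) \<in> bounded_measurable \<Omega>"
      "\<And>i. i < n \<Longrightarrow> (\<lambda>w. (xhat w - z) $ i) \<in> bounded_measurable \<Omega>" by auto
  qed (use mean_gram_carrier xhat z in \<open>auto intro: bounded_measurable_const\<close>)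
  from P.bounded_measurable_integrable[OF this]
  show int: "integrable \<Omega> (\<lambda>w. objective D A B (A *\<^sub>v z) (xhat w))"
    by (simp add: objective_eq_bform[OF z xhat])
  have "objective D A B (A *\<^sub>v z) (xhat w) \<le> (1 / real k) * (\<Sum>t=1..k. objective D A B (A *\<^sub>v z) (X t w))" for w
  proof -
    have "bform mean_gram (xhat w - z) (xhat w - z) \<le>
        (1 / real k) * (\<Sum>t=1..k. bform mean_gram (X t w - z) (X t w - z))"
      unfolding xhat_def by (rule bform_cesaro_avg_le[OF mean_gram_sym_psd X_carrier z k])
    then show ?thesis
      by (simp add: objective_eq_bform[OF z xhat] objective_eq_bform[OF z X_carrier]
          flip: sum_divide_distrib)
  qed
  then have "P.expectation (\<lambda>w. objective D A B (A *\<^sub>v z) (xhat w)) \<le>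
    P.expectation (\<lambda>w. (1 / real k) * (\<Sum>t=1..k. objective D A B (A *\<^sub>v z) (X t w)))"
    using int integrable_objective_X
    by (intro integral_mono) (auto intro!: Bochner_Integration.integrable_sum)
  also have "\<dots> = (1 / real k) * (\<Sum>t=1..k. mean_obj t)"
    using integrable_objective_X by (simp add: mean_obj_def Bochner_Integration.integral_sum)
  finally show "P.expectation (\<lambda>w. objective D A B (A *\<^sub>v z) (xhat w))
      \<le> (1 / real k) * (\<Sum>t=1..k. mean_obj t)" .
qed

end

theorem theorem3:
  fixes m n k :: nat
    and A B :: "real mat" and b x0 x1 xstar :: "real vec"
    and D :: "real mat measure" and \<Omega> :: "'w measure"
    and S :: "nat \<Rightarrow> 'w \<Rightarrow> real mat"
    and \<omega> \<beta> :: real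
  assumes A: "A \<in> carrier_mat m n"
    and b: "b \<in> carrier_vec m"
    and consistent: "\<exists>z \<in> carrier_vec n. A *\<^sub>v z = b"
    and B: "sym_pos_def n B"
    and D: "prob_space D" "sets D = sets (borel_mat m)"
    and \<Omega>: "prob_space \<Omega>"
    and indep: "prob_space.indep_vars \<Omega> (\<lambda>_. D) S {1..}"
    and distr: "\<And>i. i \<ge> 1 \<Longrightarrow> distr \<Omega> D (S i) = D"
    and x0: "x0 \<in> carrier_vec n" and x1: "x0 = x1"
    and \<beta>: "0 \<le> \<beta>" "\<beta> < 1"
    and \<omega>: "\<omega> > 0" "\<omega> + 2 * \<beta> < 2"
    and xstar: "xstar \<in> carrier_vec n" "objective D A B b xstar = 0"
    and k: "k \<ge> 1"
  defines "xhat \<equiv> (\<lambda>w. cesaro_avg n (msgd A B b \<omega> \<beta> x0 x1 (\<lambda>i. S i w)) k)"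
  shows "integrable \<Omega> (\<lambda>w. objective D A B b (xhat w)) \<and>
    (\<integral>w. objective D A B b (xhat w) \<partial>\<Omega>)
      \<le> ((1 - \<beta>)\<^sup>2 * (norm_B B (x0 - xstar))\<^sup>2 + 2 * \<omega> * \<beta> * objective D A B b x0)
        / (2 * \<omega> * (2 - 2 * \<beta> - \<omega>) * real k)"
proof -
  obtain z where z_carrier: "z \<in> carrier_vec n" and Az: "A *\<^sub>v z = b" using consistent by auto
  interpret momentum_process m n A B D \<Omega> S z x0 \<omega> \<beta>
    by (intro momentum_process.intro random_sketch.intro sketched_system.intro
        random_sketch_axioms.intro momentum_process_axioms.intro A B D \<Omega> indep distr z_carrier x0)
  have xhat: "xhat = (\<lambda>w. cesaro_avg n (\<lambda>t. X t w) k)"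
    by (simp add: xhat_def X_def iter_def Az flip: x1)
  have norm: "(norm_B B (x0 - xstar))\<^sup>2 = bform B (x0 - xstar) (x0 - xstar)"
    using sym_psdD(3)[OF B_sym_psd, of "x0 - xstar"] x0 xstar by (simp add: norm_B_def bform_def)
  define c where "c = 2 * \<omega> * (2 - 2 * \<beta> - \<omega>)"
  have c: "c > 0" using \<omega> by (simp add: c_def)
  let ?R = "(1 - \<beta>)\<^sup>2 * (norm_B B (x0 - xstar))\<^sup>2 + 2 * \<omega> * \<beta> * objective D A B b x0"
  have "c * (\<Sum>t=1..k. mean_obj t) \<le> ?R"
    using sum_mean_obj_le[of xstar k] xstar \<omega>(1) \<beta>(1) by (simp add: Az norm c_def)
  then have "(\<Sum>t=1..k. mean_obj t) \<le> ?R / c" using c by (simp add: field_simps)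
  then have "(1 / real k) * (\<Sum>t=1..k. mean_obj t) \<le> (1 / real k) * (?R / c)"
    by (rule mult_left_mono) simp
  with expectation_objective_cesaro[OF k] integrable_objective_cesaro[OF k]
  show ?thesis unfolding xhat by (simp add: Az c_def mult.commute)
qed

end
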